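(* Let the underlying space be $\mathbb{R}$ or $\mathbb{T}$. The following hold: \begin{enumerate} \item $RH_r\subsetneq\bigcap_{n\ge 2} RH^n_r$ for every $1\le r<\infty$; \item $A_r\subsetneq\bigcap_{n\ge 2} A^n_r$ for every $1<r\le\infty$; \item $BMO\subsetneq\bigcap_{n\ge 2} BMO_n$; \item $\bigcap_{n\ge 2} H^1_n\subsetneq H^1$; \item $VMO\subsetneq\bigcap_{n\ge 2} VMO_n$. \end{enumerate} Here the intersections run over all integers $n\ge 2$.
   Context: $\mathbb{T}$ is the torus $[0,1]$ with $0$ and $1$ identified (intervals in $\mathbb{T}$ are arcs). All intervals are bounded, half-open, containing their left endpoint, of positive length; $\fint_I f=\frac1{|I|}\int_I f\,dx$. A weight is a non-negative locally integrable function. For an integer $n\ge 2$, an $n$-adic interval in $\mathbb{R}$ is an interval $\left[\frac{k-1}{n^m},\frac{k}{n^m}\right)$ with $m,k\in\mathbb{Z}$; its $n$ children are the $n$ intervals of length $n^{-m-1}$ with endpoints in $n^{-m-1}\mathbb{Z}$ partitioning it. Two $n$-adic intervals are $n$-adic siblings if they are children of a common $n$-adic interval. On $\mathbb{T}$, the $n$-adic intervals are those contained in $[0,1)$. A weight $w$ is $n$-adic doubling if there is a constant $C(n)$ with $\int_{J_1}w\le C(n)\int_{J_2}w$ for all $n$-adic siblings $J_1,J_2$. Full classes: - For $1<r<\infty$, $w\in RH_r$ if there is a constant $C$ with $(\fint_I w^r)^{1/r}\le C\fint_I w$ for all intervals $I$; $RH_1=\bigcup_{r>1}RH_r$. - For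 $1<r<\infty$, $w\in A_r$ if $\sup_I\left(\fint_I w\right)\left(\fint_I w^{-1/(r-1)}\right)^{r-1}<\infty$, the supremum over all intervals $I$; $A_\infty=\bigcup_{r>1}A_r$. - $f\in BMO$ if $\sup_I\fint_I|f-\fint_I f|<\infty$, the supremum over all intervals $I$. - On $\mathbb{R}$, $f\in VMO$ if $f\in BMO$ and (a) $\lim_{\delta\to0}\sup_{|I|<\delta}\fint_I|f-\fint_I f|=0$; (b) $\lim_{N\to\infty}\sup_{|I|>N}\fint_I|f-\fint_I f|=0$; (c) $\lim_{R\to\infty}\sup_{I\cap B(0,R)=\emptyset}\fint_I|f-\fint_I f|=0$, where $B(0,R)$ is the interval centered at $0$ of radius $R$. On $\mathbb{T}$, only (a) is required. - $H^1$ is the Hardy space, characterized by the dualities $VMO^*=H^1$ and $(H^1)^*=BMO$. $n$-adic classes: $RH^n_r$, $A^n_r$, $BMO_n$, $VMO_n$ are defined in the same way with "all intervals" replaced by "all $n$-adic intervals" (and $RH^n_1=\bigcup_{r>1}RH^n_r$, $A^n_\infty=\bigcup_{r>1}A^n_r$), except that weights in $RH^n_r$ are additionally required to be $n$-adic doubling. $H^1_n$ is the $n$-adic Hardy space, with $VMO_n^*=H^1_n$ and $(H^1_n)^*=BMO_n$. As usual, $H^1$ and $H^1_n$ are realized as spaces of integrable functions: $H^1$ (respectively $H^1_n$) consists of the sums $\sum_j\lambda_j a_j$ with $\sum_j|\lambda_j|<\infty$, where each atom $a_j$ is supported in an interval (respectively $n$-adic interval) $I_j$, satisfies $|a_j|\le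 1/|I_j|$, and has $\int a_j=0$. *)

theory Defs
  imports "HOL-Analysis.Analysis"
begin

datatype ambient = Line | Torus

text \<open>
  Functions on the torus are represented by 1-periodic functions on the real line.  An arc of the
  torus is represented by its lifts, i.e. by real intervals of length at most 1 (length 1 being the
  whole circle).  Membership in all classes below is invariant under changing a function on a
  null set, within nonnegative (for weights) and periodic (on the torus) functions; so strict
  inclusion of these sets of functions is strict inclusion of the corresponding sets of
  a.e.-equivalence classes.
\<close>

definition functions_on :: "ambient \<Rightarrow> (real \<Rightarrow> real) set" where
  "functions_on s = {f. s = Torus \<longrightarrow> (\<forall>x. f (x + 1) = f x)}"

definition fundamental_domain :: "ambient \<Rightarrow> real set" where
  "fundamental_domain s = (case s of Line \<Rightarrow> UNIV | Torus \<Rightarrow> {0..<1})"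

text \<open>The set of reals that represent points of (the arc with lift) \<open>I\<close>.\<close>

definition saturation :: "ambient \<Rightarrow> real set \<Rightarrow> real set" where
  "saturation s I = (case s of Line \<Rightarrow> I | Torus \<Rightarrow> {x + of_int k | x (k::int). x \<in> I})"

definition locally_integrable :: "(real \<Rightarrow> real) \<Rightarrow> bool" where
  "locally_integrable f \<longleftrightarrow> (\<forall>a b. set_integrable lebesgue {a..b} f)"

definition weights :: "ambient \<Rightarrow> (real \<Rightarrow> real) set" where
  "weights s = {w \<in> functions_on s. locally_integrable w \<and> (\<forall>x. 0 \<le> w x)}"


subsection \<open>Intervals\<close>

definition intervals :: "ambient \<Rightarrow> real set set" where
  "intervals s = {{a..<b} | a b. a < b \<and> (s = Torus \<longrightarrow> b - a \<le> 1)}"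

definition nadic_interval :: "nat \<Rightarrow> int \<Rightarrow> int \<Rightarrow> real set" where
  "nadic_interval n m k = {(of_int k - 1) / real n powi m ..< of_int k / real n powi m}"

definition nadic_intervals :: "ambient \<Rightarrow> nat \<Rightarrow> real set set" where
  "nadic_intervals s n =
    {I. (\<exists>m k. I = nadic_interval n m k) \<and> (s = Torus \<longrightarrow> I \<subseteq> {0..<1})}"

definition nadic_children :: "nat \<Rightarrow> real set \<Rightarrow> real set set" where
  "nadic_children n I =
    {J. \<exists>m k j. I = nadic_interval n m k \<and> J = nadic_interval n (m + 1) j \<and> J \<subseteq> I}"

definition nadic_siblings :: "ambient \<Rightarrow> nat \<Rightarrow> real set \<Rightarrow> real set \<Rightarrow> bool" where
  "nadic_siblings s n J1 J2 \<longleftrightarrow>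
    (\<exists>I \<in> nadic_intervals s n. J1 \<in> nadic_children n I \<and> J2 \<in> nadic_children n I)"

definition nadic_doubling :: "ambient \<Rightarrow> nat \<Rightarrow> (real \<Rightarrow> real) \<Rightarrow> bool" where
  "nadic_doubling s n w \<longleftrightarrow>
    (\<exists>C. \<forall>J1 J2. nadic_siblings s n J1 J2 \<longrightarrow>
       (LINT x:J1|lebesgue. w x) \<le> C * (LINT x:J2|lebesgue. w x))"


subsection \<open>Function classes relative to a family of intervals\<close>

definition avg :: "real set \<Rightarrow> (real \<Rightarrow> real) \<Rightarrow> real" where
  "avg I f = (LINT x:I|lebesgue. f x) / measure lebesgue I"

definition mean_osc :: "(real \<Rightarrow> real) \<Rightarrow> real set \<Rightarrow> real" where
  "mean_osc f I = avg I (\<lambda>x. \<bar>f x - avg I f\<bar>)"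

text \<open>
  Bochner integrals of non-integrable functions are 0 by convention.  The integrability demands in
  the next two definitions express that the averages of \<open>w powr r\<close> and
  \<open>w powr (- 1 / (r - 1))\<close>, possibly infinite a priori, are finite.
\<close>

definition RH_over :: "ambient \<Rightarrow> real set set \<Rightarrow> real \<Rightarrow> (real \<Rightarrow> real) set" where
  "RH_over s F r = {w \<in> weights s. \<exists>C. \<forall>I\<in>F.
     set_integrable lebesgue I (\<lambda>x. w x powr r) \<and>
     avg I (\<lambda>x. w x powr r) powr (1 / r) \<le> C * avg I w}"

text \<open>
  Since \<open>0 powr a = 0\<close> also for negative \<open>a\<close>, whereas a negative power of the weight is infinite
  where the weight vanishes, finiteness of the average of that power includes positivity a.e.
\<close>

definition A_over :: "ambient \<Rightarrow> real set set \<Rightarrow> real \<Rightarrow> (real \<Rightarrow> real) set" where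
  "A_over s F r = {w \<in> weights s.
     (AE x in lebesgue. 0 < w x) \<and>
     (\<forall>I\<in>F. set_integrable lebesgue I (\<lambda>x. w x powr (- 1 / (r - 1)))) \<and>
     (SUP I\<in>F. ennreal (avg I w * avg I (\<lambda>x. w x powr (- 1 / (r - 1))) powr (r - 1))) < \<infinity>}"

definition BMO_over :: "ambient \<Rightarrow> real set set \<Rightarrow> (real \<Rightarrow> real) set" where
  "BMO_over s F = {f \<in> functions_on s. locally_integrable f \<and>
     (SUP I\<in>F. ennreal (mean_osc f I)) < \<infinity>}"

definition VMO_over :: "ambient \<Rightarrow> real set set \<Rightarrow> (real \<Rightarrow> real) set" where
  "VMO_over s F = {f \<in> BMO_over s F.
     ((\<lambda>\<delta>. SUP I\<in>{I\<in>F. measure lebesgue I < \<delta>}. ennreal (mean_osc f I)) \<longlongrightarrow> 0) (at_right 0) \<and>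
     (s = Line \<longrightarrow>
       ((\<lambda>N. SUP I\<in>{I\<in>F. N < measure lebesgue I}. ennreal (mean_osc f I)) \<longlongrightarrow> 0) at_top \<and>
       ((\<lambda>R. SUP I\<in>{I\<in>F. I \<inter> {-R..<R} = {}}. ennreal (mean_osc f I)) \<longlongrightarrow> 0) at_top)}"

definition atom :: "ambient \<Rightarrow> real set \<Rightarrow> (real \<Rightarrow> real) \<Rightarrow> bool" where
  "atom s I a \<longleftrightarrow> a \<in> functions_on s \<and> a \<in> borel_measurable lebesgue \<and>
     {x. a x \<noteq> 0} \<subseteq> saturation s I \<and>
     (\<forall>x. \<bar>a x\<bar> \<le> 1 / measure lebesgue I) \<and>
     (LINT x:fundamental_domain s|lebesgue. a x) = 0"

text \<open>Sums of atoms are taken in \<open>L\<^sup>1\<close> (equivalently, pointwise a.e.).\<close>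

definition H1_over :: "ambient \<Rightarrow> real set set \<Rightarrow> (real \<Rightarrow> real) set" where
  "H1_over s F = {f \<in> functions_on s.
     set_integrable lebesgue (fundamental_domain s) f \<and>
     (\<exists>(c :: nat \<Rightarrow> real) (a :: nat \<Rightarrow> real \<Rightarrow> real).
        summable (\<lambda>j. \<bar>c j\<bar>) \<and> (\<forall>j. \<exists>I\<in>F. atom s I (a j)) \<and>
        (\<lambda>N. LINT x:fundamental_domain s|lebesgue. \<bar>f x - (\<Sum>j<N. c j * a j x)\<bar>) \<longlonglongrightarrow> 0)}"


subsection \<open>Full and n-adic classes\<close>

definition RH :: "ambient \<Rightarrow> real \<Rightarrow> (real \<Rightarrow> real) set" where
  "RH s r = (if r = 1 then (\<Union>q\<in>{1<..}. RH_over s (intervals s) q)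
             else RH_over s (intervals s) r)"

definition RH_nadic :: "ambient \<Rightarrow> nat \<Rightarrow> real \<Rightarrow> (real \<Rightarrow> real) set" where
  "RH_nadic s n r = {w. nadic_doubling s n w} \<inter>
     (if r = 1 then (\<Union>q\<in>{1<..}. RH_over s (nadic_intervals s n) q)
      else RH_over s (nadic_intervals s n) r)"

definition A :: "ambient \<Rightarrow> ereal \<Rightarrow> (real \<Rightarrow> real) set" where
  "A s r = (if r = \<infinity> then (\<Union>q\<in>{1<..}. A_over s (intervals s) q)
            else A_over s (intervals s) (real_of_ereal r))"

definition A_nadic :: "ambient \<Rightarrow> nat \<Rightarrow> ereal \<Rightarrow> (real \<Rightarrow> real) set" where
  "A_nadic s n r = (if r = \<infinity> then (\<Union>q\<in>{1<..}. A_over s (nadic_intervals s n) q)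
                    else A_over s (nadic_intervals s n) (real_of_ereal r))"

definition BMO :: "ambient \<Rightarrow> (real \<Rightarrow> real) set" where
  "BMO s = BMO_over s (intervals s)"

definition BMO_nadic :: "ambient \<Rightarrow> nat \<Rightarrow> (real \<Rightarrow> real) set" where
  "BMO_nadic s n = BMO_over s (nadic_intervals s n)"

definition VMO :: "ambient \<Rightarrow> (real \<Rightarrow> real) set" where
  "VMO s = VMO_over s (intervals s)"

definition VMO_nadic :: "ambient \<Rightarrow> nat \<Rightarrow> (real \<Rightarrow> real) set" where
  "VMO_nadic s n = VMO_over s (nadic_intervals s n)"

definition H1 :: "ambient \<Rightarrow> (real \<Rightarrow> real) set" where
  "H1 s = H1_over s (intervals s)"

definition H1_nadic :: "ambient \<Rightarrow> nat \<Rightarrow> (real \<Rightarrow> real) set" where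
  "H1_nadic s n = H1_over s (nadic_intervals s n)"

end

theory Submission
  imports Defs
begin

text \<open>
  The full classes embed into the \<open>n\<close>-adic ones because \<open>n\<close>-adic intervals are intervals, apart from the
  doubling condition, which reverse Hoelder weights satisfy automatically.  Strictness exploits that no
  \<open>n\<close>-adic interval contains an integer in its interior unless its endpoints are integers,
  so no \<open>n\<close>-adic class detects a mismatch between the two sides of 0.  The functions \<open>frac x\<close>,
  \<open>frac x powr (-1/2)\<close>, \<open>ln (frac x)\<close> and a sawtooth exhibit such a mismatch for the reverse Hoelder,
  Muckenhoupt, BMO and VMO classes.  For \<open>H\<^sup>1\<close> on the line, an
  atom straddling 0 has nonzero integral over the positive half-line, which is impossible for sums of
  dyadic atoms; on the circle, a sum of atoms straddling 0 at the scales \<open>2 powr - (4 ^ i)\<close> has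
  unbounded pairings with dyadic truncations of \<open>- log x\<close>, which are uniformly bounded
  in the dual of dyadic \<open>H\<^sup>1\<close>.
\<close>

subsection \<open>Averages and periodic functions\<close>

text \<open>The weights and the logarithm are functions of the fractional part. An n-adic interval
  either sits in one cell [j, j + 1) or is a union of whole cells, so each n-adic average of such a
  function is an average over a subinterval of [0,1). One estimate on [0,1), blind to what happens
  across 0, therefore settles all n and both ambient spaces at once, whereas a short interval around
  0 sees the two unrelated ends of [0,1) together.

  The Hardy inclusion is reversed, so it suffices to leave a single n-adic class, and n = 2 is used.
  On the line no dyadic interval, however long, straddles 0, and one atom is enough. On the circle
  one atom cannot do it: a bounded function of mean zero is a multiple of an atom on the dyadic
  interval [0,1). But the normalised atom straddling 0 at scale 2^(-k) pairs to k/2 with the k-th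
  truncated logarithm. Taking k = 4^i with coefficient 2^(-i) keeps the coefficients summable, while
  the pairings grow like 2^(-i) * 4^i = 2^i.\<close>

lemma SUP_ennreal_bounded_iff:
  "(SUP i\<in>F. ennreal (h i)) < \<infinity> \<longleftrightarrow> (\<exists>C\<ge>0. \<forall>i\<in>F. h i \<le> C)"
proof
  assume lt: "(SUP i\<in>F. ennreal (h i)) < \<infinity>"
  then obtain C where C: "C \<ge> 0" "(SUP i\<in>F. ennreal (h i)) = ennreal C"
    by (cases "SUP i\<in>F. ennreal (h i)") auto
  have "h i \<le> C" if "i \<in> F" for i
  proof -
    have "ennreal (h i) \<le> ennreal C"
      using that C(2) by (metis SUP_upper)
    then show ?thesis using C(1) by (simp add: ennreal_le_iff)
  qed
  then show "\<exists>C\<ge>0. \<forall>i\<in>F. h i \<le> C" using C by blast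
next
  assume "\<exists>C\<ge>0. \<forall>i\<in>F. h i \<le> C"
  then obtain C where "C \<ge> 0" "\<forall>i\<in>F. h i \<le> C" by blast
  then have "(SUP i\<in>F. ennreal (h i)) \<le> ennreal C"
    by (auto intro!: SUP_least ennreal_leI)
  then show "(SUP i\<in>F. ennreal (h i)) < \<infinity>"
    by (simp add: order_le_less_trans)
qed

lemma set_integral_Ico_shift:
  fixes f :: "real \<Rightarrow> real"
  assumes [measurable]: "f \<in> borel_measurable borel"
  shows "set_integrable lebesgue {a + c..<b + c} f \<longleftrightarrow> set_integrable lebesgue {a..<b} (\<lambda>x. f (x + c))"
    and "(LINT x:{a + c..<b + c}|lebesgue. f x) = (LINT x:{a..<b}|lebesgue. f (x + c))"
proof -
  let ?h = "\<lambda>x. indicator {a + c..<b + c} x *\<^sub>R f x"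
  have h: "(\<lambda>x. ?h (c + 1 * x)) = (\<lambda>x. indicator {a..<b} x *\<^sub>R f (x + c))"
    by (auto simp: indicator_def fun_eq_iff algebra_simps)
  show "set_integrable lebesgue {a + c..<b + c} f \<longleftrightarrow> set_integrable lebesgue {a..<b} (\<lambda>x. f (x + c))"
    using lborel_integrable_real_affine_iff[of 1 ?h c, unfolded h]
    by (simp add: set_integrable_def integrable_completion)
  show "(LINT x:{a + c..<b + c}|lebesgue. f x) = (LINT x:{a..<b}|lebesgue. f (x + c))"
    using lborel_integral_real_affine[of 1 ?h c, unfolded h]
    by (simp add: set_lebesgue_integral_def integral_completion)
qed

lemma avg_Ico: "a \<le> b \<Longrightarrow> avg {a..<b} f = (LINT x:{a..<b}|lebesgue. f x) / (b - a)"
  by (simp add: avg_def)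

lemma borel_measurable_frac [measurable]: "(\<lambda>x::real. frac x) \<in> borel_measurable borel"
  unfolding frac_def by measurable

lemma set_integral_periodic:
  fixes g :: "real \<Rightarrow> real"
  assumes [measurable]: "g \<in> borel_measurable borel" and g: "set_integrable lebesgue {0..<1} g"
  shows "set_integrable lebesgue {of_int p..<of_int p + real N} (\<lambda>x. g (frac x))"
    and "(LINT x:{of_int p..<of_int p + real N}|lebesgue. g (frac x)) = real N * (LINT x:{0..<1}|lebesgue. g x)"
proof -
  have gm [measurable]: "(\<lambda>x. g (frac x)) \<in> borel_measurable borel" by measurable
  have unit: "set_integrable lebesgue {of_int q..<of_int q + 1} (\<lambda>x. g (frac x)) \<and>
      (LINT x:{of_int q..<of_int q + 1}|lebesgue. g (frac x)) = (LINT x:{0..<1}|lebesgue. g x)" for q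
  proof -
    have "set_integrable lebesgue {0..<1} (\<lambda>x. g (frac (x + of_int q)))"
      using g by (subst set_integrable_cong[of lebesgue lebesgue _ "{0..<1}" _ g]) auto
    moreover have "(LINT x:{0..<1}|lebesgue. g (frac (x + of_int q))) = (LINT x:{0..<1}|lebesgue. g x)"
      by (intro set_lebesgue_integral_cong) auto
    ultimately show ?thesis
      using set_integral_Ico_shift[OF gm, of 0 "of_int q" 1] by (simp add: add.commute)
  qed
  have "set_integrable lebesgue {of_int p..<of_int p + real N} (\<lambda>x. g (frac x)) \<and>
    (LINT x:{of_int p..<of_int p + real N}|lebesgue. g (frac x)) = real N * (LINT x:{0..<1}|lebesgue. g x)"
  proof (induction N)
    case 0
    then show ?case by (simp add: set_lebesgue_integral_def)
  next
    case (Suc N)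
    let ?A = "{of_int p..<of_int p + real N}"
    let ?B = "{of_int (p + int N)..<of_int (p + int N) + (1::real)}"
    have eq: "{of_int p..<of_int p + real (Suc N)} = ?A \<union> ?B" by auto
    have disj: "?A \<inter> ?B = {}" by auto
    show ?case unfolding eq
      using Suc unit[of "p + int N"]
        set_integral_Un[OF disj Suc[THEN conjunct1] unit[of "p + int N", THEN conjunct1]]
      by (auto intro!: set_integrable_Un simp: distrib_right)
  qed
  then show "set_integrable lebesgue {of_int p..<of_int p + real N} (\<lambda>x. g (frac x))"
    and "(LINT x:{of_int p..<of_int p + real N}|lebesgue. g (frac x)) = real N * (LINT x:{0..<1}|lebesgue. g x)"
    by auto
qed

section \<open>Position of n-adic intervals relative to the integers\<close>

lemma nadic_interval_nonpos:
  assumes "n \<ge> 1" "m \<le> 0"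
  defines "N \<equiv> n ^ nat (- m)"
  obtains p where "nadic_interval n m k = {of_int p..<of_int p + real N}"
proof -
  have "real n powi m = 1 / real N"
    using assms by (cases "m = 0") (simp_all add: power_int_def field_simps)
  then have "nadic_interval n m k = {of_int ((k - 1) * int N)..<of_int ((k - 1) * int N) + real N}"
    by (simp add: nadic_interval_def algebra_simps)
  then show ?thesis by (rule that)
qed

text \<open>Dividing \<open>k - 1\<close> by \<open>N\<close>, with quotient \<open>j\<close> and
  remainder \<open>i\<close>, places the interval inside the cell [j, j + 1). This is the form in
  which the absence of interior integers is used.\<close>

lemma nadic_interval_nonneg:
  assumes "n \<ge> 1" "m \<ge> 0"
  defines "N \<equiv> n ^ nat m"
  obtains i j where "i < N" "nadic_interval n m k = {real i / real N + of_int j..<real (Suc i) / real N + of_int j}"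
proof -
  have N: "N \<ge> 1" using assms by simp
  define j where "j = (k - 1) div int N"
  define i where "i = nat ((k - 1) mod int N)"
  have i: "i < N" using N by (simp add: i_def nat_less_iff)
  have "k - 1 = j * int N + int i" using N by (simp add: i_def j_def)
  then have k: "real_of_int k - 1 = of_int j * real N + real i"
    by (metis of_int_1 of_int_add of_int_diff of_int_mult of_int_of_nat_eq)
  have pw: "real n powi m = real N" using assms by (simp add: power_int_def)
  have "(of_int k - 1) / real N = real i / real N + of_int j" using k N by (simp add: field_simps)
  moreover have "of_int k / real N = real (Suc i) / real N + of_int j" using k N by (simp add: field_simps)
  ultimately show ?thesis using that[OF i, of j] by (simp add: nadic_interval_def pw)
qed

text \<open>A long interval consists of whole periods and yields [0,1) itself; a short one is
  translated into [0,1). The endpoints are obtained before \<open>g\<close>, so the same pair serves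
  a weight and all its powers.\<close>

lemma avg_nadic_frac:
  assumes "I \<in> nadic_intervals s n" "n \<ge> 1"
  obtains a b where "0 \<le> a" "a < b" "b \<le> (1::real)"
    "\<And>g. g \<in> borel_measurable borel \<Longrightarrow> set_integrable lebesgue {0..<1} g \<Longrightarrow>
      set_integrable lebesgue I (\<lambda>x. g (frac x)) \<and> avg I (\<lambda>x. g (frac x)) = avg {a..<b} g"
proof -
  obtain m k where I: "I = nadic_interval n m k"
    using assms by (auto simp: nadic_intervals_def)
  show ?thesis
  proof (cases "m \<le> 0")
    case True
    define N where "N = n ^ nat (- m)"
    have N: "N \<ge> 1" using assms(2) by (simp add: N_def)
    obtain p where "I = {of_int p..<of_int p + real N}"
      using nadic_interval_nonpos[OF assms(2) True, of k] by (auto simp: N_def I)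
    then show ?thesis
      using N by (intro that[of 0 1]) (auto simp: avg_def set_integral_periodic)
  next
    case False
    define N where "N = n ^ nat m"
    have N: "N \<ge> 1" using assms(2) by (simp add: N_def)
    obtain i j where short: "i < N"
      "I = {real i / real N + of_int j..<real (Suc i) / real N + of_int j}"
      using nadic_interval_nonneg[OF assms(2), of m k] False by (auto simp: N_def I)
    define a where "a = real i / real N"
    define b where "b = real (Suc i) / real N"
    have ab: "0 \<le> a" "a < b" "b \<le> 1" using short(1) N by (auto simp: a_def b_def field_simps)
    have I': "I = {a + of_int j..<b + of_int j}" using short(2) by (simp add: a_def b_def)
    show ?thesis
    proof (rule that[of a b])
      fix g :: "real \<Rightarrow> real"
      assume [measurable]: "g \<in> borel_measurable borel" and g: "set_integrable lebesgue {0..<1} g"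
      have gm: "(\<lambda>x. g (frac x)) \<in> borel_measurable borel" by measurable
      have gab: "set_integrable lebesgue {a..<b} g"
        by (rule set_integrable_subset[OF g]) (use ab in auto)
      have "set_integrable lebesgue {a..<b} (\<lambda>x. g (frac (x + of_int j)))"
        using gab ab by (subst set_integrable_cong[of lebesgue lebesgue _ "{a..<b}" _ g]) auto
      moreover have "(LINT x:{a..<b}|lebesgue. g (frac (x + of_int j))) = (LINT x:{a..<b}|lebesgue. g x)"
        using ab by (intro set_lebesgue_integral_cong) auto
      ultimately show "set_integrable lebesgue I (\<lambda>x. g (frac x)) \<and> avg I (\<lambda>x. g (frac x)) = avg {a..<b} g"
        using set_integral_Ico_shift[OF gm, of a "of_int j" b] ab by (simp add: avg_def I')
    qed (use ab in auto)
  qed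
qed

section \<open>Averages and mean oscillation\<close>

lemma AE_lebesgue_neq: "AE x in lebesgue. x \<noteq> (c::real)"
  by (rule AE_completion) (rule AE_lborel_singleton)

text \<open>The almost-everywhere form is meant for logarithms and negative powers, whose
  conventional values at 0 can violate the pointwise estimates.\<close>

lemma avg_mono_AE:
  assumes "set_integrable lebesgue {a..<b} f" "set_integrable lebesgue {a..<b} g" "a < b"
    and "AE x in lebesgue. x \<in> {a..<b} \<longrightarrow> f x \<le> g x"
  shows "avg {a..<b} f \<le> avg {a..<b} g"
proof -
  have "(LINT x:{a..<b}|lebesgue. f x) \<le> (LINT x:{a..<b}|lebesgue. g x)"
    using assms by (intro set_integral_mono_AE) (auto elim: eventually_mono)
  then show ?thesis
    using assms(3) by (simp add: avg_Ico divide_right_mono)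
qed

lemma avg_mono:
  assumes "set_integrable lebesgue {a..<b} f" "set_integrable lebesgue {a..<b} g" "a < b"
    and "\<And>x. a \<le> x \<Longrightarrow> x < b \<Longrightarrow> f x \<le> g x"
  shows "avg {a..<b} f \<le> avg {a..<b} g"
  using assms by (intro avg_mono_AE) auto

lemma set_integrable_Ico_const [simp]: "set_integrable lebesgue {a..<b::real} (\<lambda>x. c::real)"
proof -
  have "set_integrable lebesgue {a..<b} (\<lambda>x. 1::real)"
    unfolding set_integrable_def
    by (cases "a \<le> b") (auto intro!: integrable_real_indicator)
  then have "set_integrable lebesgue {a..<b} (\<lambda>x. c * 1)"
    by (rule set_integrable_mult_right[rotated])
  then show ?thesis by simp
qed

lemma set_integral_Ico_const: "a \<le> b \<Longrightarrow> (LINT x:{a..<b}|lebesgue. c) = (b - a) * (c::real)"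
  by (simp add: set_integral_const)

lemma avg_const: "a < b \<Longrightarrow> avg {a..<b} (\<lambda>x. c) = c"
  by (simp add: avg_Ico set_integral_Ico_const)

lemma avg_add:
  "set_integrable lebesgue I f \<Longrightarrow> set_integrable lebesgue I g \<Longrightarrow>
    avg I (\<lambda>x. f x + g x) = avg I f + avg I g"
  by (simp add: avg_def add_divide_distrib)

lemma avg_cmult: "avg I (\<lambda>x. c * f x) = c * avg I f"
  by (simp add: avg_def)

lemma avg_abs_le:
  assumes "a < b" "set_integrable lebesgue {a..<b} f"
  shows "\<bar>avg {a..<b} f\<bar> \<le> avg {a..<b} (\<lambda>x. \<bar>f x\<bar>)"
proof -
  have "set_integrable lebesgue {a..<b} (\<lambda>x. \<bar>f x\<bar>)" using assms by (intro set_integrable_abs)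
  moreover have "avg {a..<b} (\<lambda>x. - f x) = - avg {a..<b} f"
    using avg_cmult[of "{a..<b}" "-1" f] by simp
  moreover have "set_integrable lebesgue {a..<b} (\<lambda>x. - f x)"
    using set_integrable_mult_right[of "-1" lebesgue "{a..<b}" f] assms by simp
  ultimately show ?thesis
    using avg_mono[OF assms(2) _ assms(1), of "\<lambda>x. \<bar>f x\<bar>"]
      avg_mono[of a b "\<lambda>x. - f x" "\<lambda>x. \<bar>f x\<bar>"] assms
    by (auto simp: abs_le_iff)
qed

lemma set_integrable_dist:
  fixes a b :: real
  assumes "set_integrable lebesgue {a..<b} f"
  shows "set_integrable lebesgue {a..<b} (\<lambda>x. \<bar>f x - c\<bar> :: real)"
  by (intro set_integrable_abs set_integral_diff(1) assms) simp

text \<open>The distance from the mean to any constant \<open>c\<close> is at most the average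
  distance of \<open>f\<close> to \<open>c\<close>, so replacing the mean by a convenient
  \<open>c\<close> costs only a factor 2.\<close>

lemma mean_osc_le:
  assumes "a < b" and f: "set_integrable lebesgue {a..<b} f"
  shows "mean_osc f {a..<b} \<le> 2 * avg {a..<b} (\<lambda>x. \<bar>f x - c\<bar>)"
proof -
  let ?m = "avg {a..<b} f" and ?d = "avg {a..<b} (\<lambda>x. \<bar>f x - c\<bar>)"
  have "avg {a..<b} (\<lambda>x. f x - c) = ?m - c"
    using avg_add[OF f, of "\<lambda>x. -c"] avg_const[OF assms(1), of "-c"] by simp
  then have m: "\<bar>?m - c\<bar> \<le> ?d"
    using avg_abs_le[OF assms(1), of "\<lambda>x. f x - c"] f by (simp add: set_integral_diff)
  have "mean_osc f {a..<b} \<le> avg {a..<b} (\<lambda>x. \<bar>f x - c\<bar> + \<bar>?m - c\<bar>)"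
    unfolding mean_osc_def
    by (rule avg_mono) (use assms in \<open>auto intro!: set_integrable_dist set_integral_add(1)\<close>)
  also have "\<dots> = ?d + \<bar>?m - c\<bar>"
    by (subst avg_add) (use assms in \<open>auto simp: avg_const intro!: set_integrable_dist\<close>)
  finally show ?thesis using m by simp
qed

text \<open>The oscillation about the mean is the average of the oscillations on the two halves, and
  each of these is at least the distance of the half's own average to the mean; the triangle
  inequality finishes. This turns a mismatch at 0 into a lower bound.\<close>

lemma mean_osc_ge_jump:
  assumes "t > 0" and f: "set_integrable lebesgue {-t..<t} f"
  shows "\<bar>avg {0..<t} f - avg {-t..<0} f\<bar> / 2 \<le> mean_osc f {-t..<t}"
proof -
  define c where "c = avg {-t..<t} f"
  have fR: "set_integrable lebesgue {0..<t} f" and fL: "set_integrable lebesgue {-t..<0} f"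
    using assms by (auto intro: set_integrable_subset[OF f])
  have 1: "\<bar>avg {0..<t} f - c\<bar> \<le> avg {0..<t} (\<lambda>x. \<bar>f x - c\<bar>)"
    using avg_abs_le[of 0 t "\<lambda>x. f x - c"] avg_add[OF fR, of "\<lambda>x. -c"] avg_const[of 0 t "-c"]
      assms fR by (simp add: set_integral_diff)
  have 2: "\<bar>avg {-t..<0} f - c\<bar> \<le> avg {-t..<0} (\<lambda>x. \<bar>f x - c\<bar>)"
    using avg_abs_le[of "-t" 0 "\<lambda>x. f x - c"] avg_add[OF fL, of "\<lambda>x. -c"] avg_const[of "-t" 0 "-c"]
      assms fL by (simp add: set_integral_diff)
  have un: "{-t..<t} = {-t..<0} \<union> {0..<t}" using assms by auto
  have "(LINT x:{-t..<t}|lebesgue. \<bar>f x - c\<bar>) =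
     (LINT x:{-t..<0}|lebesgue. \<bar>f x - c\<bar>) + (LINT x:{0..<t}|lebesgue. \<bar>f x - c\<bar>)"
    unfolding un by (rule set_integral_Un) (use fR fL in \<open>auto intro!: set_integrable_dist\<close>)
  then have "mean_osc f {-t..<t} = (avg {-t..<0} (\<lambda>x. \<bar>f x - c\<bar>) + avg {0..<t} (\<lambda>x. \<bar>f x - c\<bar>)) / 2"
    using assms by (simp add: mean_osc_def c_def[symmetric] avg_Ico field_simps)
  then show ?thesis using 1 2 by (simp add: field_simps)
qed

lemma locally_integrable_frac:
  assumes "g \<in> borel_measurable borel" "set_integrable lebesgue {0..<1} g"
  shows "locally_integrable (\<lambda>x. g (frac x))"
  unfolding locally_integrable_def
proof (intro allI)
  fix a b :: real
  have "real_of_int \<lfloor>a\<rfloor> + real (nat (\<lfloor>b\<rfloor> + 1 - \<lfloor>a\<rfloor>)) > b" by linarith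
  then have "{a..b} \<subseteq> {of_int \<lfloor>a\<rfloor>..<of_int \<lfloor>a\<rfloor> + real (nat (\<lfloor>b\<rfloor> + 1 - \<lfloor>a\<rfloor>))}"
    by auto linarith
  then show "set_integrable lebesgue {a..b} (\<lambda>x. g (frac x))"
    by (rule set_integrable_subset[OF set_integral_periodic(1)[OF assms], rotated]) simp
qed

lemma locally_integrable_Ico:
  "locally_integrable f \<Longrightarrow> set_integrable lebesgue {a..<b} f"
  unfolding locally_integrable_def
  by (rule set_integrable_subset[of _ "{a..b}"]) auto

lemma mean_osc_nadic_frac:
  assumes "I \<in> nadic_intervals s n" "n \<ge> 1"
    and [measurable]: "g \<in> borel_measurable borel" and g: "set_integrable lebesgue {0..<1} g"
  obtains a b where "0 \<le> a" "a < b" "b \<le> 1" "mean_osc (\<lambda>x. g (frac x)) I = mean_osc g {a..<b}"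
proof -
  obtain a b where ab: "0 \<le> a" "a < b" "b \<le> (1::real)"
    and *: "\<And>g. g \<in> borel_measurable borel \<Longrightarrow> set_integrable lebesgue {0..<1} g \<Longrightarrow>
      avg I (\<lambda>x. g (frac x)) = avg {a..<b} g"
    using avg_nadic_frac[OF assms(1,2)] by metis
  have "avg I (\<lambda>x. \<bar>g (frac x) - c\<bar>) = avg {a..<b} (\<lambda>x. \<bar>g x - c\<bar>)" for c
    by (rule *) (use g in \<open>auto intro!: set_integrable_dist\<close>)
  then show ?thesis
    using that[OF ab] *[OF assms(3,4)] by (simp add: mean_osc_def)
qed

section \<open>Integrals of the model functions\<close>

lemma set_integral_Ico_of_has_integral:
  fixes f :: "real \<Rightarrow> real"
  assumes "(f has_integral v) {a..b}" "\<And>x. x \<in> {a..b} \<Longrightarrow> 0 \<le> f x"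
  shows "set_integrable lebesgue {a..<b} f" "(LINT x:{a..<b}|lebesgue. f x) = v"
proof -
  have 1: "set_integrable lebesgue {a..b} f"
    using assms by (intro nonnegative_absolutely_integrable_1) auto
  then show "set_integrable lebesgue {a..<b} f"
    by (rule set_integrable_subset) auto
  have "(LINT x:{a..<b}|lebesgue. f x) = (LINT x:{a..b}|lebesgue. f x)"
    by (rule set_integral_discrete_difference[where X="{b}"]) auto
  also have "\<dots> = v"
    using set_lebesgue_integral_eq_integral(2)[OF 1] assms(1) by (simp add: integral_unique)
  finally show "(LINT x:{a..<b}|lebesgue. f x) = v" .
qed

lemma set_integral_inverse_sqrt:
  assumes "0 \<le> a" "a \<le> b"
  shows "set_integrable lebesgue {a..<b} (\<lambda>x::real. x powr (-1/2))"
    "(LINT x:{a..<b}|lebesgue. x powr (-1/2)) = 2 * sqrt b - 2 * sqrt a"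
proof -
  have "((\<lambda>x. x powr (-1/2)) has_integral (2 * sqrt b - 2 * sqrt a)) {a..b}"
  \<comment> \<open>The interior version is used because the square root is not differentiable at 0,
    which may be the endpoint \<open>a\<close>.\<close>
  proof (rule fundamental_theorem_of_calculus_interior)
    fix x assume x: "x \<in> {a<..<b}"
    have "x powr (-1/2) = inverse (sqrt x)"
      using x assms by (simp add: powr_minus powr_half_sqrt)
    then show "((\<lambda>x. 2 * sqrt x) has_vector_derivative x powr (-1/2)) (at x)"
      using x assms unfolding has_real_derivative_iff_has_vector_derivative[symmetric]
      by (auto intro!: derivative_eq_intros)
  qed (use assms in \<open>auto intro!: continuous_intros\<close>)
  then show "set_integrable lebesgue {a..<b} (\<lambda>x::real. x powr (-1/2))"
    "(LINT x:{a..<b}|lebesgue. x powr (-1/2)) = 2 * sqrt b - 2 * sqrt a"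
    by (auto intro: set_integral_Ico_of_has_integral)
qed

text \<open>This is the \<open>A\<close>-condition with exponent 1 for the inverse square root: its
  average is at most twice its smallest value 1 / sqrt b. It yields both the Muckenhoupt bounds for
  every exponent and the BMO bound for the logarithm.\<close>

lemma avg_inverse_sqrt_le:
  assumes "0 \<le> a" "a < b"
  shows "avg {a..<b} (\<lambda>x. x powr (-1/2)) * sqrt b \<le> 2"
proof -
  define d where "d = sqrt b - sqrt a"
  have "d * sqrt b \<le> d * (sqrt b + sqrt a)"
    using assms by (intro mult_left_mono) (auto simp: d_def)
  also have "\<dots> = b - a" using assms by (simp add: d_def algebra_simps)
  finally have "(2 * d) / (b - a) * sqrt b \<le> 2"
    using assms by (simp add: divide_le_eq)
  moreover have "avg {a..<b} (\<lambda>x. x powr (-1/2)) = (2 * d) / (b - a)"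
    unfolding d_def right_diff_distrib avg_Ico[OF less_imp_le[OF assms(2)]]
      set_integral_inverse_sqrt(2)[OF assms(1) less_imp_le[OF assms(2)]] ..
  ultimately show ?thesis by simp
qed

lemma set_integral_id_Ico:
  assumes "0 \<le> a" "a \<le> b"
  shows "set_integrable lebesgue {a..<b} (\<lambda>x::real. x)"
    "(LINT x:{a..<b}|lebesgue. x) = (b\<^sup>2 - a\<^sup>2) / 2"
proof -
  have "((\<lambda>x. x) has_integral (b\<^sup>2 - a\<^sup>2) / 2) {a..b}"
    using assms by (intro ident_has_integral)
  then show "set_integrable lebesgue {a..<b} (\<lambda>x::real. x)"
    "(LINT x:{a..<b}|lebesgue. x) = (b\<^sup>2 - a\<^sup>2) / 2"
    using assms by (intro set_integral_Ico_of_has_integral; auto)+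
qed

lemma avg_id: "0 \<le> a \<Longrightarrow> a < b \<Longrightarrow> avg {a..<b} (\<lambda>x. x) = (a + b) / 2"
  by (simp add: avg_Ico set_integral_id_Ico power2_eq_square field_simps)

lemma set_integrable_bounded:
  fixes f :: "real \<Rightarrow> real"
  assumes "f \<in> borel_measurable lebesgue" "\<And>x. a \<le> x \<Longrightarrow> x < b \<Longrightarrow> \<bar>f x\<bar> \<le> C"
  shows "set_integrable lebesgue {a..<b} f"
  by (rule set_integrable_bound[of lebesgue "{a..<b}" "\<lambda>x. C"])
     (use assms in \<open>auto simp: set_borel_measurable_def intro!: AE_I2 order_trans[OF _ abs_ge_self]
        borel_measurable_times borel_measurable_indicator\<close>)

section \<open>Inclusions between the classes\<close>

lemma nadic_intervals_subset: "n \<ge> 1 \<Longrightarrow> nadic_intervals s n \<subseteq> intervals s"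
proof
  fix I assume n: "n \<ge> 1" and "I \<in> nadic_intervals s n"
  then obtain m k where I: "I = nadic_interval n m k" and T: "s = Torus \<Longrightarrow> I \<subseteq> {0..<1}"
    by (auto simp: nadic_intervals_def)
  define a b where "a = (of_int k - 1) / real n powi m" and "b = of_int k / real n powi m"
  have "real n powi m > 0" using n by simp
  then have "a < b" by (simp add: a_def b_def divide_strict_right_mono)
  moreover have "I = {a..<b}" by (simp add: I nadic_interval_def a_def b_def)
  moreover have "s = Torus \<Longrightarrow> b - a \<le> 1"
    using T \<open>I = {a..<b}\<close> \<open>a < b\<close> by auto
  ultimately show "I \<in> intervals s" by (auto simp: intervals_def)
qed

lemma frac_function_on: "(\<lambda>x. g (frac x)) \<in> functions_on s"
  by (simp add: functions_on_def frac_1_eq)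

lemma centered_interval: "0 < t \<Longrightarrow> t \<le> 1/2 \<Longrightarrow> {-t..<t} \<in> intervals s"
  unfolding intervals_def by (rule CollectI, rule exI[of _ "-t"], rule exI[of _ t]) auto

lemma frac_neg_eq: "-1 \<le> x \<Longrightarrow> x < 0 \<Longrightarrow> frac x = 1 + (x::real)"
  using frac_1_eq[of x] frac_eq[of "x + 1"] by (simp add: add.commute)

lemma A_over_antimono: "F \<subseteq> G \<Longrightarrow> A_over s G q \<subseteq> A_over s F q"
  unfolding A_over_def SUP_ennreal_bounded_iff by blast

lemma BMO_over_antimono: "F \<subseteq> G \<Longrightarrow> BMO_over s G \<subseteq> BMO_over s F"
  unfolding BMO_over_def SUP_ennreal_bounded_iff by blast

lemma RH_over_antimono: "F \<subseteq> G \<Longrightarrow> RH_over s G q \<subseteq> RH_over s F q"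
  unfolding RH_over_def by blast

lemma H1_over_mono: "F \<subseteq> G \<Longrightarrow> H1_over s F \<subseteq> H1_over s G"
  unfolding H1_over_def by blast

lemma tendsto_SUP_zero_antimono:
  fixes h :: "'a \<Rightarrow> ennreal"
  assumes "F \<subseteq> G" "((\<lambda>d. SUP i\<in>{i\<in>G. P d i}. h i) \<longlongrightarrow> 0) L"
  shows "((\<lambda>d. SUP i\<in>{i\<in>F. P d i}. h i) \<longlongrightarrow> 0) L"
proof (rule tendsto_sandwich[OF _ _ tendsto_const assms(2)])
  show "\<forall>\<^sub>F d in L. (SUP i\<in>{i\<in>F. P d i}. h i) \<le> (SUP i\<in>{i\<in>G. P d i}. h i)"
    using assms(1) by (intro always_eventually allI SUP_subset_mono) auto
qed auto

lemma VMO_over_antimono: 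
  assumes "F \<subseteq> G" shows "VMO_over s G \<subseteq> VMO_over s F"
proof
  fix f assume f: "f \<in> VMO_over s G"
  note mono = tendsto_SUP_zero_antimono[OF assms, where h = "\<lambda>I. ennreal (mean_osc f I)"]
  show "f \<in> VMO_over s F"
    using f BMO_over_antimono[OF assms, of s] mono[where P = "\<lambda>\<delta> I. measure lebesgue I < \<delta>"]
      mono[where P = "\<lambda>N I. N < measure lebesgue I"] mono[where P = "\<lambda>R I. I \<inter> {-R..<R} = {}"]
    by (auto simp: VMO_over_def)
qed


subsection \<open>BMO\<close>

text \<open>Apply ln y \<le> y - 1 to y = sqrt (b / x), whose logarithm is half of ln (b /
  x).\<close>

lemma ln_le_inverse_sqrt:
  assumes "0 < x" "x \<le> b"
  shows "\<bar>ln x - ln b\<bar> \<le> 2 * sqrt b * x powr (-1/2 :: real)"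
proof -
  have "ln (sqrt (b / x)) \<le> sqrt (b / x) - 1"
    using assms by (intro ln_le_minus_one) auto
  then have "ln (b / x) \<le> 2 * sqrt (b / x)"
    using assms by (simp add: ln_sqrt)
  moreover have "sqrt (b / x) = sqrt b * x powr (-1/2)"
    using assms by (simp add: powr_minus powr_half_sqrt real_sqrt_divide field_simps)
  ultimately show ?thesis using assms by (simp add: ln_div)
qed

lemma set_integrable_ln:
  assumes "0 \<le> a" "b \<le> 1"
  shows "set_integrable lebesgue {a..<b} (ln :: real \<Rightarrow> real)"
proof (rule set_integrable_subset[of _ "{0..<1}"])
  show "set_integrable lebesgue {0..<1} (ln :: real \<Rightarrow> real)"
  proof (rule set_integrable_bound)
    show "set_integrable lebesgue {0..<1} (\<lambda>x::real. 2 * x powr (-1/2))"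
      using set_integral_inverse_sqrt(1)[of 0 1] by (intro set_integrable_mult_right) auto
    show "AE x in lebesgue. x \<in> {0..<1} \<longrightarrow> norm (ln x) \<le> norm (2 * x powr (-1/2) :: real)"
      using AE_lebesgue_neq[of 0]
    proof eventually_elim
      fix x :: real assume "x \<noteq> 0"
      then show "x \<in> {0..<1} \<longrightarrow> norm (ln x) \<le> norm (2 * x powr (-1/2))"
        using ln_le_inverse_sqrt[of x 1] by auto
    qed
  qed (simp add: set_borel_measurable_def measurable_completion)
qed (use assms in auto)

text \<open>Comparing with the constant ln b makes the estimate scale invariant: the average of sqrt
  (b / x) is at most 2, which gives 4 for the distance to ln b and 8 for the oscillation.\<close>

lemma mean_osc_ln:
  assumes "0 \<le> a" "a < b" "b \<le> 1"
  shows "mean_osc ln {a..<b} \<le> 8"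
proof -
  have "avg {a..<b} (\<lambda>x. \<bar>ln x - ln b\<bar>) \<le> avg {a..<b} (\<lambda>x. 2 * sqrt b * x powr (-1/2))"
  proof (rule avg_mono_AE)
    show "AE x in lebesgue. x \<in> {a..<b} \<longrightarrow> \<bar>ln x - ln b\<bar> \<le> 2 * sqrt b * x powr (-1/2)"
      using AE_lebesgue_neq[of 0]
      by eventually_elim (use assms ln_le_inverse_sqrt[of _ b] in force)
  qed (use assms set_integral_inverse_sqrt(1)[of a b] in
        \<open>auto intro!: set_integrable_ln set_integrable_dist set_integrable_mult_right\<close>)
  also have "\<dots> = 2 * (avg {a..<b} (\<lambda>x. x powr (-1/2)) * sqrt b)"
    by (simp add: avg_cmult)
  also have "\<dots> \<le> 4" using avg_inverse_sqrt_le[OF assms(1,2)] by (simp add: mult.commute)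
  finally show ?thesis
    using mean_osc_le[OF assms(2) set_integrable_ln[OF assms(1,3)], of "ln b"] by simp
qed

lemma ln_frac_in_BMO_nadic:
  assumes "n \<ge> 1" shows "(\<lambda>x. ln (frac x)) \<in> BMO_nadic s n"
proof -
  have "mean_osc (\<lambda>x. ln (frac x)) I \<le> 8" if "I \<in> nadic_intervals s n" for I
    by (rule mean_osc_nadic_frac[OF that assms, of ln])
       (use set_integrable_ln[of 0 1] in \<open>auto intro: mean_osc_ln\<close>)
  then show ?thesis
    unfolding BMO_nadic_def BMO_over_def SUP_ennreal_bounded_iff
    using locally_integrable_frac[of ln] set_integrable_ln[of 0 1] frac_function_on[of ln]
    by (auto intro!: exI[of _ 8])
qed

lemma ln_frac_not_in_BMO: "(\<lambda>x. ln (frac x)) \<notin> BMO s"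
proof
  assume "(\<lambda>x. ln (frac x)) \<in> BMO s"
  then obtain C where C: "\<forall>I\<in>intervals s. mean_osc (\<lambda>x. ln (frac x)) I \<le> C" "C \<ge> 0"
    unfolding BMO_def BMO_over_def SUP_ennreal_bounded_iff by blast
  \<comment> \<open>With this \<open>t\<close> the right-hand average is at most -(2C + 1) - ln 2
    and the left-hand one at least -ln 2, so the jump is at least 2C + 1 and the oscillation exceeds
    \<open>C\<close>. The division by 2 keeps \<open>t\<close> below 1/2, where the lower bound on
    the left holds.\<close>
  define t :: real where "t = exp (- (2 * C + 1)) / 2"
  have t: "0 < t" "t \<le> 1/2" using C by (auto simp: t_def)
  have ln_t: "ln t = - (2 * C + 1) - ln 2" by (simp add: t_def ln_div)
  have li: "locally_integrable (\<lambda>x. ln (frac x))"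
    using set_integrable_ln[of 0 1] by (intro locally_integrable_frac) auto
  have R: "avg {0..<t} (\<lambda>x. ln (frac x)) \<le> ln t"
  proof -
    have "avg {0..<t} (\<lambda>x. ln (frac x)) \<le> avg {0..<t} (\<lambda>x. ln t)"
    proof (rule avg_mono_AE)
      show "AE x in lebesgue. x \<in> {0..<t} \<longrightarrow> ln (frac x) \<le> ln t"
        using AE_lebesgue_neq[of 0] by eventually_elim (use t in auto)
    qed (use t in \<open>auto intro!: locally_integrable_Ico li\<close>)
    then show ?thesis using t by (simp add: avg_const)
  qed
  have L: "avg {-t..<0} (\<lambda>x. ln (frac x)) \<ge> ln (1/2)"
  proof -
    have "avg {-t..<0} (\<lambda>x. ln (frac x)) \<ge> avg {-t..<0} (\<lambda>x. ln (1/2))"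
      by (rule avg_mono) (use t in \<open>auto intro!: locally_integrable_Ico li simp: frac_neg_eq\<close>)
    then show ?thesis using t by (simp add: avg_const)
  qed
  have "\<bar>avg {0..<t} (\<lambda>x. ln (frac x)) - avg {-t..<0} (\<lambda>x. ln (frac x))\<bar> \<ge> 2 * C + 1"
    using R L ln_t by (simp add: ln_div)
  then have "mean_osc (\<lambda>x. ln (frac x)) {-t..<t} \<ge> (2 * C + 1) / 2"
    using mean_osc_ge_jump[OF t(1), of "\<lambda>x. ln (frac x)"] li by (force intro: locally_integrable_Ico)
  moreover have "mean_osc (\<lambda>x. ln (frac x)) {-t..<t} \<le> C"
    using C(1) centered_interval[OF t] by blast
  ultimately show False by simp
qed

lemma BMO_strict: "BMO s \<subset> (\<Inter>n\<in>{2..}. BMO_nadic s n)"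
proof (rule psubsetI)
  show "BMO s \<subseteq> (\<Inter>n\<in>{2..}. BMO_nadic s n)"
    unfolding BMO_def BMO_nadic_def
    by (intro INF_greatest BMO_over_antimono nadic_intervals_subset) simp
  show "BMO s \<noteq> (\<Inter>n\<in>{2..}. BMO_nadic s n)"
    using ln_frac_in_BMO_nadic[of _ s] ln_frac_not_in_BMO[of s] by auto
qed

subsection \<open>VMO\<close>

text \<open>On the line only one tooth is kept, because the periodic function would keep oscillating
  on long and on distant intervals and so violate the two conditions at infinity. That tooth jumps
  from 0 to 1 at 0 and descends continuously to 0 at 1.\<close>

definition sawtooth :: "ambient \<Rightarrow> real \<Rightarrow> real" where
  "sawtooth s x = (if s = Torus \<or> 0 \<le> x \<and> x < 1 then 1 - frac x else 0)"

lemma sawtooth_bounds: "0 \<le> sawtooth s x" "sawtooth s x \<le> 1"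
  using frac_lt_1[of x] frac_ge_0[of x] by (auto simp: sawtooth_def)

lemma borel_measurable_sawtooth [measurable]: "sawtooth s \<in> borel_measurable borel"
  unfolding sawtooth_def by measurable

lemma locally_integrable_sawtooth: "locally_integrable (sawtooth s)"
  unfolding locally_integrable_def
proof (intro allI)
  fix a b :: real
  have "set_integrable lebesgue {a..<b + 1} (sawtooth s)"
    using sawtooth_bounds[of s] by (intro set_integrable_bounded[where C=1]) (auto simp: measurable_completion)
  then show "set_integrable lebesgue {a..b} (sawtooth s)"
    by (rule set_integrable_subset) auto
qed

lemma mean_osc_sawtooth_le_avg:
  assumes "a < b" shows "mean_osc (sawtooth s) {a..<b} \<le> 2 * avg {a..<b} (sawtooth s)"
  using mean_osc_le[OF assms locally_integrable_Ico[OF locally_integrable_sawtooth], of s 0]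
    sawtooth_bounds(1)[of s] by simp

text \<open>An n-adic interval shorter than 1 lies in a single cell [j, j + 1), where the function
  is affine of slope -1 or identically 0. It therefore varies by at most the length of the interval,
  and the jump is never met.\<close>

lemma mean_osc_sawtooth_nadic:
  assumes "I \<in> nadic_intervals s n" "n \<ge> 1" "measure lebesgue I < 1"
  shows "mean_osc (sawtooth s) I \<le> 2 * measure lebesgue I"
proof -
  obtain m k where I: "I = nadic_interval n m k"
    using assms by (auto simp: nadic_intervals_def)
  have m: "m > 0"
  proof (rule ccontr)
    assume "\<not> m > 0"
    then obtain p where "I = {of_int p..<of_int p + real (n ^ nat (- m))}"
      using nadic_interval_nonpos[OF assms(2), of m k] by (auto simp: I)
    then have "measure lebesgue I = real (n ^ nat (- m))" by simp
    moreover have "real (n ^ nat (- m)) \<ge> 1" using assms(2) by (simp del: of_nat_power)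
    ultimately show False using assms(3) by linarith
  qed
  define N where "N = n ^ nat m"
  have N: "N \<ge> 1" using assms(2) by (simp add: N_def)
  obtain i j where ij: "i < N"
      "I = {real i / real N + of_int j..<real (Suc i) / real N + of_int j}"
    using nadic_interval_nonneg[OF assms(2), of m k] m by (auto simp: N_def I)
  define a where "a = real i / real N"
  define b where "b = real (Suc i) / real N"
  have ab: "0 \<le> a" "a < b" "b \<le> 1" using ij(1) N by (auto simp: a_def b_def field_simps)
  have I': "I = {a + of_int j..<b + of_int j}" using ij(2) by (simp add: a_def b_def)
  have fr: "frac x = x - of_int j" if "x \<in> I" for x
    using that ab frac_unique_iff[of x "x - of_int j"] by (auto simp: I')
  have st: "(\<forall>x\<in>I. sawtooth s x = 1 - (x - of_int j)) \<or> (\<forall>x\<in>I. sawtooth s x = 0)"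
  proof (cases "s = Torus \<or> j = 0")
    case True
    then show ?thesis using fr ab by (auto simp: sawtooth_def I')
  next
    case False
    then have "j \<ge> 1 \<or> j \<le> -1" by linarith
    then have "real_of_int j \<ge> 1 \<or> real_of_int j \<le> -1"
      by (metis of_int_1 of_int_le_iff of_int_minus)
    then show ?thesis using False ab by (auto simp: sawtooth_def I')
  qed
  let ?c = "sawtooth s (a + of_int j)"
  have "avg I (\<lambda>x. \<bar>sawtooth s x - ?c\<bar>) \<le> avg I (\<lambda>x. b - a)"
    unfolding I'
  proof (rule avg_mono)
    fix x assume "a + of_int j \<le> x" "x < b + of_int j"
    then show "\<bar>sawtooth s x - ?c\<bar> \<le> b - a"
      using st ab by (auto simp: I')
  qed (use ab in \<open>auto intro: set_integrable_dist locally_integrable_Ico locally_integrable_sawtooth\<close>)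
  also have "\<dots> = b - a" using ab by (simp add: I' avg_const)
  finally show ?thesis
    using mean_osc_le[OF _ locally_integrable_Ico[OF locally_integrable_sawtooth[of s]],
        of "a + of_int j" "b + of_int j" ?c] ab
    by (simp add: I')
qed

lemma tendsto_SUP_zero:
  fixes h :: "'a \<Rightarrow> real" and u :: "real \<Rightarrow> real"
  assumes "\<forall>\<^sub>F d in L. \<forall>i\<in>S d. h i \<le> u d" "(u \<longlongrightarrow> 0) L"
  shows "((\<lambda>d. SUP i\<in>S d. ennreal (h i)) \<longlongrightarrow> 0) L"
proof (rule tendsto_sandwich[OF _ _ tendsto_const])
  show "\<forall>\<^sub>F d in L. (SUP i\<in>S d. ennreal (h i)) \<le> ennreal (u d)"
    using assms(1) by eventually_elim (auto intro!: SUP_least ennreal_leI)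
  show "((\<lambda>d. ennreal (u d)) \<longlongrightarrow> 0) L"
    using tendsto_ennrealI[OF assms(2)] by simp
qed auto

lemma nadic_interval_Ico:
  assumes "I \<in> nadic_intervals s n" "n \<ge> 1"
  obtains a b where "a < b" "I = {a..<b}"
  using nadic_intervals_subset[OF assms(2), of s] assms(1) by (auto simp: intervals_def)

lemma sawtooth_in_VMO_nadic:
  assumes n: "n \<ge> 1" shows "sawtooth s \<in> VMO_nadic s n"
proof -
  have "mean_osc (sawtooth s) I \<le> 2" if I: "I \<in> nadic_intervals s n" for I
  proof -
    obtain a b where ab: "a < b" "I = {a..<b}" using nadic_interval_Ico[OF I n] .
    have "avg {a..<b} (sawtooth s) \<le> avg {a..<b} (\<lambda>x. 1)"
      using ab locally_integrable_Ico[OF locally_integrable_sawtooth]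
      by (intro avg_mono) (auto simp: sawtooth_bounds)
    then show ?thesis
      using mean_osc_sawtooth_le_avg[OF ab(1), of s] ab by (simp add: avg_const)
  qed
  moreover have "sawtooth s \<in> functions_on s"
    by (simp add: functions_on_def sawtooth_def frac_1_eq)
  ultimately have bmo: "sawtooth s \<in> BMO_over s (nadic_intervals s n)"
    unfolding BMO_over_def SUP_ennreal_bounded_iff
    using locally_integrable_sawtooth by (auto intro!: exI[of _ 2])
  have 1: "((\<lambda>\<delta>. SUP I\<in>{I\<in>nadic_intervals s n. measure lebesgue I < \<delta>}.
      ennreal (mean_osc (sawtooth s) I)) \<longlongrightarrow> 0) (at_right 0)"
  proof (rule tendsto_SUP_zero)
    have "\<forall>\<^sub>F \<delta> in at_right 0. \<delta> < (1::real)"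
      by (rule eventually_at_rightI[of 0 1]) auto
    then show "\<forall>\<^sub>F \<delta> in at_right 0. \<forall>I\<in>{I \<in> nadic_intervals s n. measure lebesgue I < \<delta>}.
        mean_osc (sawtooth s) I \<le> 2 * \<delta>"
      by eventually_elim (use mean_osc_sawtooth_nadic[OF _ n, of _ s] in force)
    show "((\<lambda>\<delta>. 2 * \<delta>) \<longlongrightarrow> 0) (at_right (0::real))"
      by (auto intro!: tendsto_eq_intros)
  qed
  have 2: "((\<lambda>N. SUP I\<in>{I\<in>nadic_intervals s n. N < measure lebesgue I}.
      ennreal (mean_osc (sawtooth s) I)) \<longlongrightarrow> 0) at_top" if s: "s = Line"
  proof (rule tendsto_SUP_zero)
    show "\<forall>\<^sub>F N in at_top. \<forall>I\<in>{I\<in>nadic_intervals s n. N < measure lebesgue I}.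
        mean_osc (sawtooth s) I \<le> 2 / N"
      using eventually_gt_at_top[of 0]
    proof eventually_elim
      case (elim N)
      show ?case
      proof safe
        fix I assume I: "I \<in> nadic_intervals s n" "N < measure lebesgue I"
        obtain a b where ab: "a < b" "I = {a..<b}" using nadic_interval_Ico[OF I(1) n] .
        \<comment> \<open>The single tooth has mass at most 1 in total, so its average over an
          interval longer than \<open>N\<close> is at most 1 / N.\<close>
        have "(LINT x:{a..<b}|lebesgue. sawtooth s x) \<le> (LINT x|lebesgue. indicator {0..<1::real} x)"
          unfolding set_lebesgue_integral_def
        proof (rule integral_mono)
          show "integrable lebesgue (\<lambda>x. indicator {a..<b} x *\<^sub>R sawtooth s x)"
            using locally_integrable_Ico[OF locally_integrable_sawtooth, of a b s] by (simp add: set_integrable_def)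
          show "integrable lebesgue (indicator {0..<1::real} :: real \<Rightarrow> real)"
            by (rule integrable_real_indicator) auto
        qed (use sawtooth_bounds[of s] s in \<open>auto simp: indicator_def sawtooth_def\<close>)
        also have "\<dots> = 1" by simp
        finally have "avg {a..<b} (sawtooth s) \<le> 1 / (b - a)"
          using ab by (simp add: avg_Ico divide_right_mono)
        also have "\<dots> \<le> 1 / N" using I ab elim by (intro divide_left_mono) auto
        finally show "mean_osc (sawtooth s) I \<le> 2 / N"
          using mean_osc_sawtooth_le_avg[OF ab(1), of s] ab by simp
      qed
    qed
    show "((\<lambda>N. 2 / N) \<longlongrightarrow> 0) (at_top :: real filter)"
      by (intro tendsto_divide_0[OF tendsto_const]) (auto intro: filterlim_at_top_imp_at_infinity filterlim_ident)
  qed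
  have 3: "((\<lambda>R. SUP I\<in>{I\<in>nadic_intervals s n. I \<inter> {-R..<R} = {}}.
      ennreal (mean_osc (sawtooth s) I)) \<longlongrightarrow> 0) at_top" if s: "s = Line"
  proof (rule tendsto_SUP_zero)
    \<comment> \<open>As soon as R \<ge> 1, an interval avoiding {-R..<R} misses the tooth
      altogether.\<close>
    show "\<forall>\<^sub>F R in at_top. \<forall>I\<in>{I\<in>nadic_intervals s n. I \<inter> {-R..<R} = {}}.
        mean_osc (sawtooth s) I \<le> 0"
      using eventually_ge_at_top[of 1]
    proof eventually_elim
      case (elim R)
      show ?case
      proof safe
        fix I assume I: "I \<in> nadic_intervals s n" "I \<inter> {-R..<R} = {}"
        obtain a b where ab: "a < b" "I = {a..<b}" using nadic_interval_Ico[OF I(1) n] .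
        have "sawtooth s x = 0" if "x \<in> I" for x
        proof -
          have "x \<notin> {-R..<R}" using that I(2) by blast
          then show ?thesis using elim s by (auto simp: sawtooth_def)
        qed
        then have "avg {a..<b} (sawtooth s) \<le> avg {a..<b} (\<lambda>x. 0)"
          using ab locally_integrable_Ico[OF locally_integrable_sawtooth] by (intro avg_mono) auto
        then show "mean_osc (sawtooth s) I \<le> 0"
          using mean_osc_sawtooth_le_avg[OF ab(1), of s] ab by (simp add: avg_const)
      qed
    qed
  qed simp
  show ?thesis
    unfolding VMO_nadic_def VMO_over_def using bmo 1 2 3 by blast
qed

lemma sawtooth_not_in_VMO: "sawtooth s \<notin> VMO s"
proof
  assume "sawtooth s \<in> VMO s"
  then have "((\<lambda>\<delta>. SUP I\<in>{I\<in>intervals s. measure lebesgue I < \<delta>}.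
      ennreal (mean_osc (sawtooth s) I)) \<longlongrightarrow> 0) (at_right 0)"
    by (simp add: VMO_def VMO_over_def)
  then have "\<forall>\<^sub>F \<delta> in at_right 0. (SUP I\<in>{I\<in>intervals s. measure lebesgue I < \<delta>}.
      ennreal (mean_osc (sawtooth s) I)) < ennreal (1/4)"
    by (rule order_tendstoD) simp
  moreover have "\<forall>\<^sub>F \<delta> in at_right 0. 0 < \<delta> \<and> \<delta> < (1::real)"
    by (rule eventually_at_rightI[of 0 1]) auto
  ultimately have "\<forall>\<^sub>F \<delta>::real in at_right 0. False"
  proof eventually_elim
    case (elim \<delta>)
    \<comment> \<open>Now [-t, t) is shorter than \<delta>, and t \<le> 1/4 puts the averages at
      least at 3/4 on the right and at most at 1/4 on the left. The jump 1/2 forces oscillation 1/4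
      at every scale.\<close>
    define t where "t = \<delta> / 4"
    have t: "0 < t" "t \<le> 1/4" "2 * t < \<delta>" using elim by (auto simp: t_def)
    note int = locally_integrable_Ico[OF locally_integrable_sawtooth]
    have "avg {0..<t} (sawtooth s) \<ge> avg {0..<t} (\<lambda>x. 3/4)"
      by (rule avg_mono) (use t in \<open>auto simp: sawtooth_def intro!: int\<close>)
    moreover have "avg {-t..<0} (sawtooth s) \<le> avg {-t..<0} (\<lambda>x. 1/4)"
      by (rule avg_mono) (use t in \<open>auto simp: sawtooth_def frac_neg_eq intro!: int\<close>)
    ultimately have "1/4 \<le> mean_osc (sawtooth s) {-t..<t}"
      using mean_osc_ge_jump[OF t(1) int, of s] t by (simp add: avg_const)
    then have "ennreal (1/4) \<le> ennreal (mean_osc (sawtooth s) {-t..<t})" by (rule ennreal_leI)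
    also have "\<dots> \<le> (SUP I\<in>{I\<in>intervals s. measure lebesgue I < \<delta>}. ennreal (mean_osc (sawtooth s) I))"
      using t centered_interval[of t s] by (intro SUP_upper) auto
    finally show False using elim by simp
  qed
  then show False by simp
qed

lemma VMO_strict: "VMO s \<subset> (\<Inter>n\<in>{2..}. VMO_nadic s n)"
proof (rule psubsetI)
  show "VMO s \<subseteq> (\<Inter>n\<in>{2..}. VMO_nadic s n)"
    unfolding VMO_def VMO_nadic_def
    by (intro INF_greatest VMO_over_antimono nadic_intervals_subset) simp
  show "VMO s \<noteq> (\<Inter>n\<in>{2..}. VMO_nadic s n)"
    using sawtooth_in_VMO_nadic[of _ s] sawtooth_not_in_VMO[of s] by auto
qed

subsection \<open>Muckenhoupt classes\<close>

lemma AE_notin_Ints: "AE x::real in lebesgue. x \<notin> \<int>"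
proof (rule AE_completion)
  have "countable (\<int> :: real set)" by (auto simp: Ints_def)
  then show "AE x::real in lborel. x \<notin> \<int>"
    by (intro AE_not_in countable_imp_null_set_lborel)
qed

text \<open>For a non-negative function either half alone bounds the full average from below. In the
  Muckenhoupt product the weight can thus be estimated on the right of 0 and its dual power on the
  left.\<close>

lemma avg_centered_ge:
  assumes "t > 0" and f: "set_integrable lebesgue {-t..<t} f" "\<And>x. 0 \<le> f x"
  shows "avg {0..<t} f / 2 \<le> avg {-t..<t} f" "avg {-t..<0} f / 2 \<le> avg {-t..<t} f"
proof -
  have fR: "set_integrable lebesgue {0..<t} f" and fL: "set_integrable lebesgue {-t..<0} f"
    using assms by (auto intro: set_integrable_subset[OF f(1)])
  have un: "{-t..<t} = {-t..<0} \<union> {0..<t}" using assms by auto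
  have "(LINT x:{-t..<t}|lebesgue. f x) = (LINT x:{-t..<0}|lebesgue. f x) + (LINT x:{0..<t}|lebesgue. f x)"
    unfolding un by (rule set_integral_Un) (use fR fL in auto)
  then have "avg {-t..<t} f = (avg {-t..<0} f + avg {0..<t} f) / 2"
    using assms by (simp add: avg_Ico field_simps)
  moreover have "avg {0..<t} f \<ge> 0" "avg {-t..<0} f \<ge> 0"
    using assms avg_mono[of 0 t "\<lambda>x. 0" f] avg_mono[of "-t" 0 "\<lambda>x. 0" f] fR fL by (auto simp: avg_const)
  ultimately show "avg {0..<t} f / 2 \<le> avg {-t..<t} f" "avg {-t..<0} f / 2 \<le> avg {-t..<t} f"
    by auto
qed

lemma set_integrable_inverse_sqrt_powr:
  assumes "q > 1" shows "set_integrable lebesgue {0..<1} (\<lambda>x. (x powr (-1/2)) powr (-1/(q - 1)) :: real)"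
proof (rule set_integrable_bounded)
  fix x :: real assume "0 \<le> x" "x < 1"
  then show "\<bar>(x powr (-1/2)) powr (-1/(q - 1))\<bar> \<le> 1"
    using assms by (auto simp: powr_powr intro!: powr_le1)
qed (simp add: measurable_completion)

text \<open>On a subinterval [a, b) of [0,1) the dual power \<open>?v\<close> is increasing, so its
  average is at most its value at \<open>b\<close>, and raising that to the power q - 1 gives sqrt
  b. Then \<open>avg_inverse_sqrt_le\<close> bounds the product by 2, whatever \<open>q\<close> and
  \<open>n\<close> are.\<close>

lemma inverse_sqrt_frac_in_A_nadic:
  assumes n: "n \<ge> 1" and q: "q > 1"
  shows "(\<lambda>x. frac x powr (-1/2)) \<in> A_over s (nadic_intervals s n) q"
proof -
  let ?w = "\<lambda>x::real. x powr (-1/2)" and ?v = "\<lambda>x::real. (x powr (-1/2)) powr (-1/(q - 1))"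
  have w: "?w \<in> borel_measurable borel" "set_integrable lebesgue {0..<1} ?w"
    using set_integral_inverse_sqrt(1)[of 0 1] by auto
  have v: "?v \<in> borel_measurable borel" "set_integrable lebesgue {0..<1} ?v"
    using set_integrable_inverse_sqrt_powr[OF q] by auto
  have *: "set_integrable lebesgue I (\<lambda>x. ?v (frac x)) \<and>
      avg I (\<lambda>x. ?w (frac x)) * avg I (\<lambda>x. ?v (frac x)) powr (q - 1) \<le> 2"
    if I: "I \<in> nadic_intervals s n" for I
  proof -
    obtain a b where ab: "0 \<le> a" "a < b" "b \<le> (1::real)"
      and T: "\<And>g. g \<in> borel_measurable borel \<Longrightarrow> set_integrable lebesgue {0..<1} g \<Longrightarrow>
        set_integrable lebesgue I (\<lambda>x. g (frac x)) \<and> avg I (\<lambda>x. g (frac x)) = avg {a..<b} g"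
      using avg_nadic_frac[OF I n] by metis
    have vab: "set_integrable lebesgue {a..<b} ?v"
      by (rule set_integrable_subset[OF v(2)]) (use ab in auto)
    have wab: "set_integrable lebesgue {a..<b} ?w"
      by (rule set_integrable_subset[OF w(2)]) (use ab in auto)
    have "avg {a..<b} ?v \<le> avg {a..<b} (\<lambda>x. ?v b)"
    proof (rule avg_mono[OF vab _ ab(2)])
      fix x assume x: "a \<le> x" "x < b"
      show "?v x \<le> ?v b"
        using x ab q by (auto simp: powr_powr intro!: powr_mono2)
    qed simp
    then have "avg {a..<b} ?v \<le> ?v b" using ab by (simp add: avg_const)
    moreover have "0 \<le> avg {a..<b} ?v"
      using avg_mono[OF _ vab ab(2), of "\<lambda>x. 0"] ab by (simp add: avg_const)
    ultimately have "avg {a..<b} ?v powr (q - 1) \<le> ?v b powr (q - 1)"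
      using q by (intro powr_mono2) auto
    also have "\<dots> = b powr (1/2)"
    proof -
      have "- 1 / 2 * (- 1 / (q - 1)) * (q - 1) = 1 / 2" using q by simp
      then show ?thesis unfolding powr_powr by (rule arg_cong)
    qed
    also have "\<dots> = sqrt b" using ab by (simp add: powr_half_sqrt)
    finally have le: "avg {a..<b} ?v powr (q - 1) \<le> sqrt b" .
    have "0 \<le> avg {a..<b} ?w"
      using avg_mono[OF _ wab ab(2), of "\<lambda>x. 0"] ab by (simp add: avg_const)
    then have "avg {a..<b} ?w * avg {a..<b} ?v powr (q - 1) \<le> avg {a..<b} ?w * sqrt b"
      using le by (intro mult_left_mono)
    also have "\<dots> \<le> 2" by (rule avg_inverse_sqrt_le) (use ab in auto)
    finally show ?thesis using T[OF v] T[OF w] by simp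
  qed
  \<comment> \<open>At the integers the weight has the conventional value
    \<open>0 powr (-1/2) = 0\<close>, so positivity holds only almost everywhere.\<close>
  have "AE x::real in lebesgue. 0 < frac x powr (-1/2)"
    using AE_notin_Ints by eventually_elim auto
  moreover have "(\<lambda>x. frac x powr (-1/2)) \<in> weights s"
    using locally_integrable_frac[OF w] frac_function_on[of ?w s] by (auto simp: weights_def)
  ultimately show ?thesis
    unfolding A_over_def SUP_ennreal_bounded_iff using * by (auto intro!: exI[of _ 2])
qed

text \<open>On [-t, t) the average of the weight grows like 1 / sqrt t because of the right half,
  while the dual power stays bounded below on the left half, where the fractional part is near
  1.\<close>

lemma inverse_sqrt_frac_not_in_A:
  assumes q: "q > 1"
  shows "(\<lambda>x. frac x powr (-1/2)) \<notin> A_over s (intervals s) q"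
proof
  let ?w = "\<lambda>x::real. frac x powr (-1/2)"
  let ?v = "\<lambda>x::real. (frac x powr (-1/2)) powr (-1/(q - 1))"
  assume "?w \<in> A_over s (intervals s) q"
  then obtain C where C: "C \<ge> 0" "\<forall>I\<in>intervals s. avg I ?w * avg I ?v powr (q - 1) \<le> C"
    unfolding A_over_def SUP_ennreal_bounded_iff by blast
  \<comment> \<open>2K is the value of the dual power at fractional part 1/2, a lower bound for it
    on the left half; halving accounts for \<open>avg_centered_ge\<close>.\<close>
  define K where "K = ((1/2) powr (-1/2)) powr (-1/(q - 1)) / (2::real)"
  define K2 where "K2 = K powr (q - 1)"
  have K: "0 < K" "0 < K2" by (auto simp: K_def K2_def)
  \<comment> \<open>\<open>r\<close> is sqrt t. The product of averages will be at least K2 / r, and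
    r \<le> K2 / (C + 1) makes this exceed \<open>C\<close>.\<close>
  define r where "r = min (1/2) (K2 / (C + 1))"
  define t where "t = r\<^sup>2"
  have r: "0 < r" "r \<le> 1/2" "r \<le> K2 / (C + 1)" using K C min.cobounded1[of "1/2" "K2 / (C + 1)"] min.cobounded2[of "1/2" "K2 / (C + 1)"]
    unfolding r_def[symmetric] by (auto simp: r_def)
  have "t \<le> (1/2)\<^sup>2" using r unfolding t_def by (intro power_mono) auto
  then have t: "0 < t" "t \<le> 1/2" using r by (auto simp: t_def power2_eq_square)
  have lw: "locally_integrable ?w"
    using set_integral_inverse_sqrt(1)[of 0 1] by (intro locally_integrable_frac) auto
  have lv: "locally_integrable ?v"
    using set_integrable_inverse_sqrt_powr[OF q]
    by (intro locally_integrable_frac[of "\<lambda>x. (x powr (-1/2)) powr (-1/(q - 1))"]) auto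
  have "avg {0..<t} ?w = avg {0..<t} (\<lambda>x. x powr (-1/2))"
    unfolding avg_def using t by (auto intro!: arg_cong2[where f="(/)"] set_lebesgue_integral_cong)
  also have "\<dots> = 2 * sqrt t / t"
    unfolding avg_Ico[OF less_imp_le[OF t(1)]] set_integral_inverse_sqrt(2)[OF order_refl less_imp_le[OF t(1)]]
    by simp
  also have "\<dots> = 2 / r" using r by (simp add: t_def power2_eq_square)
  finally have "1 / r \<le> avg {-t..<t} ?w"
    using avg_centered_ge(1)[OF t(1) locally_integrable_Ico[OF lw]] by simp
  moreover have "K2 \<le> avg {-t..<t} ?v powr (q - 1)"
  proof -
    have "avg {-t..<0} (\<lambda>x. 2 * K) \<le> avg {-t..<0} ?v"
    proof (rule avg_mono)
      fix x assume x: "-t \<le> x" "x < 0"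
      show "2 * K \<le> ?v x"
        using x t q by (auto simp: K_def frac_neg_eq powr_powr intro!: powr_mono2)
    qed (use t lv in \<open>auto intro: locally_integrable_Ico\<close>)
    then have "K \<le> avg {-t..<t} ?v"
      using avg_centered_ge(2)[OF t(1) locally_integrable_Ico[OF lv]] t by (simp add: avg_const)
    then show ?thesis unfolding K2_def using K q by (intro powr_mono2) auto
  qed
  ultimately have "1 / r * K2 \<le> avg {-t..<t} ?w * avg {-t..<t} ?v powr (q - 1)"
    using K r by (intro mult_mono) (auto intro: order_trans[rotated])
  also have "\<dots> \<le> C" using C(2) centered_interval[OF t] by blast
  finally have "K2 \<le> C * r" using r by (simp add: field_simps)
  moreover have "(C + 1) * r \<le> K2" using r C by (simp add: field_simps)
  ultimately show False using r by (simp add: algebra_simps)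
qed

lemma A_strict:
  assumes "1 < r" "r \<le> \<infinity>" shows "A s r \<subset> (\<Inter>n\<in>{2..}. A_nadic s n r)"
proof (rule psubsetI)
  have sub: "A_over s (intervals s) q \<subseteq> A_over s (nadic_intervals s n) q" if "n \<ge> 2" for n q
    using that by (intro A_over_antimono nadic_intervals_subset) simp
  then show "A s r \<subseteq> (\<Inter>n\<in>{2..}. A_nadic s n r)"
    unfolding A_def A_nadic_def by fastforce
  have r: "r = \<infinity> \<or> real_of_ereal r > 1" using assms by (cases r) auto
  let ?w = "\<lambda>x::real. frac x powr (-1/2)"
  \<comment> \<open>For r = \<infinity> the class is a union, so one exponent, here 2, gives
    membership, whereas non-membership below has to exclude every exponent.\<close>
  have "?w \<in> A_nadic s n r" if "n \<ge> 2" for n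
    using r inverse_sqrt_frac_in_A_nadic[of n 2 s] inverse_sqrt_frac_in_A_nadic[of n "real_of_ereal r" s] that
    by (auto simp: A_nadic_def)
  moreover have "?w \<notin> A s r"
    using r inverse_sqrt_frac_not_in_A[of _ s] by (auto simp: A_def)
  ultimately show "A s r \<noteq> (\<Inter>n\<in>{2..}. A_nadic s n r)" by auto
qed

subsection \<open>Reverse Hoelder classes\<close>

lemma weight_integral_mono:
  assumes w: "w \<in> weights s" and "E \<in> sets lebesgue" "E \<subseteq> {a..<b}"
  shows "set_integrable lebesgue E w" "0 \<le> (LINT x:E|lebesgue. w x)"
    "(LINT x:E|lebesgue. w x) \<le> (LINT x:{a..<b}|lebesgue. w x)"
proof -
  have I: "set_integrable lebesgue {a..<b} w"
    using w by (intro locally_integrable_Ico) (simp add: weights_def)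
  have pos: "\<And>x. 0 \<le> w x" using w by (simp add: weights_def)
  show E: "set_integrable lebesgue E w" by (rule set_integrable_subset[OF I assms(2,3)])
  show "0 \<le> (LINT x:E|lebesgue. w x)"
    unfolding set_lebesgue_integral_def using pos by (intro Bochner_Integration.integral_nonneg) simp
  show "(LINT x:E|lebesgue. w x) \<le> (LINT x:{a..<b}|lebesgue. w x)"
    unfolding set_lebesgue_integral_def
    by (intro integral_mono) (use E I pos assms(3) in \<open>auto simp: set_integrable_def indicator_def\<close>)
qed

text \<open>
  Splitting \<open>w\<close> at height \<open>l = K \<cdot> avg I w\<close> gives \<open>w \<le> l + l powr (1 - q) * w powr q\<close>, whose second
  term contributes at most a quarter of the mass of \<open>I\<close> once \<open>K\<close> is large.
\<close>

lemma RH_small_subset: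
  assumes w: "w \<in> RH_over s F q" and q: "q > 1"
  obtains \<epsilon> where "\<epsilon> > 0"
    "\<And>a b E. {a..<b} \<in> F \<Longrightarrow> a < b \<Longrightarrow> E \<in> sets lebesgue \<Longrightarrow> E \<subseteq> {a..<b} \<Longrightarrow>
      measure lebesgue E \<le> \<epsilon> * (b - a) \<Longrightarrow>
      (LINT x:E|lebesgue. w x) \<le> (LINT x:{a..<b}|lebesgue. w x) / 2"
proof -
  have ws: "w \<in> weights s" using w by (simp add: RH_over_def)
  have pos: "\<And>x. 0 \<le> w x" using ws by (simp add: weights_def)
  obtain C0 where C0: "\<And>I. I \<in> F \<Longrightarrow> set_integrable lebesgue I (\<lambda>x. w x powr q) \<and>
     avg I (\<lambda>x. w x powr q) powr (1 / q) \<le> C0 * avg I w"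
    using w unfolding RH_over_def by blast
  \<comment> \<open>\<open>C0\<close> is an arbitrary real, so it is enlarged to be positive before
    powers are taken. \<open>K\<close> is then the solution of
    \<open>K powr (1 - q) * C powr q = 1/4\<close>.\<close>
  define C where "C = max 1 C0"
  define K where "K = (4 * C powr q) powr (1 / (q - 1))"
  have C: "C \<ge> 1" by (simp add: C_def)
  have K: "K > 0" using C by (auto simp: K_def)
  have KC: "K powr (1 - q) * C powr q = 1 / 4"
  proof -
    have "1 / (q - 1) * (1 - q) = -1" using q by (simp add: field_simps)
    then have "K powr (1 - q) = (4 * C powr q) powr (-1)"
      unfolding K_def powr_powr by simp
    then show ?thesis using C by (simp add: powr_minus field_simps)
  qed
  show ?thesis
  \<comment> \<open>On a set of measure at most (b - a) / (4K) the constant l = K m integrates to at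
    most a quarter of m (b - a); with the quarter from the second term this makes one half.\<close>
  proof (rule that[of "1 / (4 * K)"])
    fix a b E assume I: "{a..<b} \<in> F" "a < b" and E: "E \<in> sets lebesgue" "E \<subseteq> {a..<b}"
      and small: "measure lebesgue E \<le> 1 / (4 * K) * (b - a)"
    let ?I = "{a..<b}"
    define m where "m = avg ?I w"
    note wE = weight_integral_mono[OF ws E]
    have m: "(LINT x:?I|lebesgue. w x) = m * (b - a)"
      using I by (simp add: m_def avg_Ico)
    have m0: "m \<ge> 0" using order_trans[OF wE(2,3)] I(2) by (simp add: m zero_le_mult_iff)
    show "(LINT x:E|lebesgue. w x) \<le> (LINT x:?I|lebesgue. w x) / 2"
    \<comment> \<open>The height \<open>l\<close> must be positive for its negative power to be
      meaningful, so the massless interval is treated separately.\<close>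
    proof (cases "m = 0")
      case True
      then show ?thesis using wE(2,3) by (simp add: m)
    next
      case False
      then have mp: "m > 0" using m0 by simp
      define l where "l = K * m"
      have l: "l > 0" using K mp by (simp add: l_def)
      have int: "set_integrable lebesgue ?I (\<lambda>x. w x powr q)" using C0[OF I(1)] by simp
      have split: "w x \<le> l + l powr (1 - q) * w x powr q" for x
      proof (cases "w x \<le> l")
        case False
        then have "w x powr (1 - q) \<le> l powr (1 - q)"
          using l q by (intro powr_mono2') auto
        then have "w x powr (1 - q) * w x powr q \<le> l powr (1 - q) * w x powr q"
          by (rule mult_right_mono) simp
        then show ?thesis using False l by (simp add: powr_add[symmetric])
      qed (use l in \<open>auto intro: add_increasing2\<close>)
      have lI: "set_integrable lebesgue E (\<lambda>x. l)"
        by (rule set_integrable_subset[OF set_integrable_Ico_const E])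
      have pI: "set_integrable lebesgue E (\<lambda>x. l powr (1 - q) * w x powr q)"
        by (rule set_integrable_subset[OF _ E]) (use int in \<open>auto intro: set_integrable_mult_right\<close>)
      have Efin: "emeasure lebesgue E < \<infinity>"
        using emeasure_mono[OF E(2), of lebesgue] I by (auto intro: le_less_trans)
      have "(LINT x:E|lebesgue. w x) \<le> (LINT x:E|lebesgue. l + l powr (1 - q) * w x powr q)"
        by (intro set_integral_mono) (use wE(1) lI pI split in auto)
      also have "\<dots> = (LINT x:E|lebesgue. l) + (LINT x:E|lebesgue. l powr (1 - q) * w x powr q)"
        by (rule set_integral_add(2)[OF lI pI])
      also have "(LINT x:E|lebesgue. l) = measure lebesgue E * l"
        using E(1) Efin by (subst set_integral_const) auto
      also have "(LINT x:E|lebesgue. l powr (1 - q) * w x powr q) \<le>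
          (LINT x:?I|lebesgue. l powr (1 - q) * w x powr q)"
        unfolding set_lebesgue_integral_def
      proof (rule integral_mono)
        show "integrable lebesgue (\<lambda>x. indicat_real E x *\<^sub>R (l powr (1 - q) * w x powr q))"
          using pI by (simp add: set_integrable_def)
        show "integrable lebesgue (\<lambda>x. indicat_real ?I x *\<^sub>R (l powr (1 - q) * w x powr q))"
          using set_integrable_mult_right[OF int, of "l powr (1 - q)"] by (simp add: set_integrable_def)
      qed (use E(2) in \<open>auto simp: indicator_def\<close>)
      also have "\<dots> = l powr (1 - q) * (avg ?I (\<lambda>x. w x powr q) * (b - a))"
        using I by (simp add: avg_Ico)
      also have "\<dots> \<le> l powr (1 - q) * ((C * m) powr q * (b - a))"
      proof -
        let ?A = "avg ?I (\<lambda>x. w x powr q)"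
        have A: "0 \<le> ?A"
          using avg_mono[OF _ int I(2), of "\<lambda>x. 0"] I by (simp add: avg_const)
        have "C0 * m \<le> C * m" using mp by (intro mult_right_mono) (auto simp: C_def)
        then have "?A powr (1 / q) \<le> C * m"
          using C0[OF I(1)] unfolding m_def[symmetric] by linarith
        then have "(?A powr (1 / q)) powr q \<le> (C * m) powr q"
          using q by (intro powr_mono2) auto
        then have "?A \<le> (C * m) powr q" using q A by (simp add: powr_powr)
        then show ?thesis using I by (intro mult_left_mono mult_right_mono) auto
      qed
      also have "\<dots> = (K powr (1 - q) * C powr q) * (m powr (1 - q) * m powr q) * (b - a)"
        using K C mp by (simp add: l_def powr_mult)
      also have "m powr (1 - q) * m powr q = m" using mp by (simp add: powr_add[symmetric])
      also have "K powr (1 - q) * C powr q = 1 / 4" by (rule KC)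
      finally have "(LINT x:E|lebesgue. w x) \<le> measure lebesgue E * l + 1 / 4 * m * (b - a)" by simp
      moreover have "measure lebesgue E * l \<le> 1 / (4 * K) * (b - a) * l"
        using small l by (intro mult_right_mono) auto
      moreover have "1 / (4 * K) * (b - a) * l = 1 / 4 * m * (b - a)" using K by (simp add: l_def)
      ultimately show ?thesis by (simp add: m)
    qed
  qed (use K in auto)
qed

text \<open>
  The inner interval is grown linearly to the outer one in \<open>M\<close> steps, each of which adds so
  little length that it at most doubles the mass.
\<close>

lemma mass_growth:
  assumes w: "w \<in> weights s" and abcd: "a \<le> c" "c < d" "d \<le> b" and "M \<ge> 1"
    and \<epsilon>: "\<epsilon> > 0" "b - a \<le> real M * (\<epsilon> * (d - c))"
    and small: "\<And>a' b' E. a \<le> a' \<Longrightarrow> a' < b' \<Longrightarrow> b' \<le> b \<Longrightarrow> E \<in> sets lebesgue \<Longrightarrow> E \<subseteq> {a'..<b'} \<Longrightarrow>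
      measure lebesgue E \<le> \<epsilon> * (b' - a') \<Longrightarrow>
      (LINT x:E|lebesgue. w x) \<le> (LINT x:{a'..<b'}|lebesgue. w x) / 2"
  shows "(LINT x:{a..<b}|lebesgue. w x) \<le> 2 ^ M * (LINT x:{c..<d}|lebesgue. w x)"
proof -
  define l where "l i = c - real i / real M * (c - a)" for i
  define r where "r i = d + real i / real M * (b - d)" for i
  have M: "real M > 0" using assms by simp
  have "i \<le> M \<Longrightarrow> (LINT x:{l i..<r i}|lebesgue. w x) \<le> 2 ^ i * (LINT x:{c..<d}|lebesgue. w x)" for i
  proof (induction i)
    case 0
    then show ?case by (simp add: l_def r_def)
  next
    case (Suc i)
    define E where "E = {l (Suc i)..<l i} \<union> {r i..<r (Suc i)}"
    define u v where "u = (c - a) / real M" and "v = (b - d) / real M"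
    have lS: "l (Suc i) = l i - u" using M by (simp add: l_def u_def field_simps)
    have rS: "r (Suc i) = r i + v" using M by (simp add: r_def v_def field_simps)
    have ca: "u \<ge> 0" "v \<ge> 0" using abcd M by (auto simp: u_def v_def)
    have lr: "l i \<le> c" "d \<le> r i" using abcd M by (auto simp: l_def r_def)
    have fr: "real (Suc i) / real M \<le> 1" using Suc.prems M by simp
    have la: "a \<le> l (Suc i)"
      using mult_right_mono[OF fr, of "c - a"] abcd by (simp add: l_def)
    have rb: "r (Suc i) \<le> b"
      using mult_right_mono[OF fr, of "b - d"] abcd by (simp add: r_def)
    have mE: "measure lebesgue E \<le> \<epsilon> * (r (Suc i) - l (Suc i))"
    proof -
      have "measure lebesgue E \<le> measure lebesgue {l (Suc i)..<l i} + measure lebesgue {r i..<r (Suc i)}"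
        unfolding E_def by (rule measure_Un_le) auto
      also have "\<dots> = u + v"
        using ca by (simp add: lS rS)
      \<comment> \<open>Here u + v = ((b - a) - (d - c)) / M, and \<open>M\<close> was assumed large
        enough for this.\<close>
      also have "\<dots> \<le> \<epsilon> * (d - c)"
        using \<epsilon> abcd M by (simp add: u_def v_def add_divide_distrib[symmetric] field_simps)
      also have "\<dots> \<le> \<epsilon> * (r (Suc i) - l (Suc i))"
        using \<epsilon>(1) lr ca lS rS by (intro mult_left_mono) auto
      finally show ?thesis .
    qed
    have "(LINT x:E|lebesgue. w x) \<le> (LINT x:{l (Suc i)..<r (Suc i)}|lebesgue. w x) / 2"
      by (rule small[OF la _ rb _ _ mE]) (use lr abcd ca in \<open>auto simp: E_def lS rS\<close>)
    moreover have un: "{l (Suc i)..<r (Suc i)} = {l i..<r i} \<union> E"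
      using lr abcd ca by (auto simp: E_def lS rS)
    moreover have "(LINT x:{l i..<r i} \<union> E|lebesgue. w x) =
        (LINT x:{l i..<r i}|lebesgue. w x) + (LINT x:E|lebesgue. w x)"
    proof (rule set_integral_Un)
      show "set_integrable lebesgue {l i..<r i} w"
        by (rule weight_integral_mono(1)[OF w _ order_refl]) auto
      show "set_integrable lebesgue E w"
        using un by (intro weight_integral_mono(1)[OF w, of _ "l (Suc i)" "r (Suc i)"]) (auto simp: E_def)
    qed (auto simp: E_def)
    \<comment> \<open>The added set \<open>E\<close> carries at most half of the new mass, so the
      old interval carries at least half of it.\<close>
    ultimately have "(LINT x:{l (Suc i)..<r (Suc i)}|lebesgue. w x) \<le> 2 * (LINT x:{l i..<r i}|lebesgue. w x)"
      by simp
    then show ?case using Suc by simp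
  qed
  from this[of M] show ?thesis using M by (simp add: l_def r_def)
qed

text \<open>Each child comes with its own level and index for the common parent. The length of the
  parent fixes \<open>real n powi m\<close>, the only way in which the level enters an interval, so
  both children can be described at one level.\<close>

lemma nadic_child_cases:
  assumes "nadic_siblings s n J1 J2" "n \<ge> 1"
  obtains m k i j where "nadic_interval n m k \<in> nadic_intervals s n"
    "J1 = nadic_interval n (m + 1) i" "J1 \<subseteq> nadic_interval n m k"
    "J2 = nadic_interval n (m + 1) j" "J2 \<subseteq> nadic_interval n m k"
proof -
  obtain I m k m' k' i j where I: "I \<in> nadic_intervals s n" "I = nadic_interval n m k"
      "J1 = nadic_interval n (m + 1) i" "J1 \<subseteq> I"
      "I = nadic_interval n m' k'" "J2 = nadic_interval n (m' + 1) j" "J2 \<subseteq> I"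
    using assms unfolding nadic_siblings_def nadic_children_def by blast
  have len: "measure lebesgue (nadic_interval n m k) = 1 / real n powi m" for m k
  proof -
    have "real n powi m > 0" using assms by simp
    then show ?thesis by (simp add: nadic_interval_def diff_divide_distrib)
  qed
  have "real n powi m = real n powi m'"
    using len[of m k] len[of m' k'] I(2,5) by (metis div_by_1 divide_divide_eq_right mult_1)
  then have "real n powi (m + 1) = real n powi (m' + 1)"
    using assms by (simp add: power_int_add)
  then have "J2 = nadic_interval n (m + 1) j" using I by (simp add: nadic_interval_def)
  then show ?thesis using that I by metis
qed

lemma nadic_interval_eq_Ico:
  "nadic_interval n m k = {(of_int k - 1) / real n powi m..<(of_int k - 1) / real n powi m + 1 / real n powi m}"
  by (simp add: nadic_interval_def diff_divide_distrib)

text \<open>One sibling has at most the mass of the parent, and the parent is grown out of the other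
  sibling by \<open>mass_growth\<close>. The intermediate intervals are not n-adic, so the reverse
  Hoelder condition on all intervals is used here.\<close>

lemma RH_doubling:
  assumes w: "w \<in> RH_over s (intervals s) q" and q: "q > 1" and n: "n \<ge> 1"
  shows "nadic_doubling s n w"
proof -
  obtain \<epsilon> where \<epsilon>: "\<epsilon> > 0" and small: "\<And>a b E. {a..<b} \<in> intervals s \<Longrightarrow> a < b \<Longrightarrow>
      E \<in> sets lebesgue \<Longrightarrow> E \<subseteq> {a..<b} \<Longrightarrow> measure lebesgue E \<le> \<epsilon> * (b - a) \<Longrightarrow>
      (LINT x:E|lebesgue. w x) \<le> (LINT x:{a..<b}|lebesgue. w x) / 2"
    using RH_small_subset[OF w q] by metis
  have ws: "w \<in> weights s" using w by (simp add: RH_over_def)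
  \<comment> \<open>The parent is n times as long as a child, so n / \<epsilon> steps suffice,
    independently of the scale.\<close>
  obtain M :: nat where M: "real M \<ge> real n / \<epsilon>" using real_arch_simple by blast
  have "real n / \<epsilon> > 0" using \<epsilon> n by simp
  then have M1: "M \<ge> 1" using M by (cases M) auto
  have "(LINT x:J1|lebesgue. w x) \<le> 2 ^ M * (LINT x:J2|lebesgue. w x)"
    if sib: "nadic_siblings s n J1 J2" for J1 J2
  proof -
    obtain m k i j where I: "nadic_interval n m k \<in> nadic_intervals s n"
      and J1: "J1 = nadic_interval n (m + 1) i" "J1 \<subseteq> nadic_interval n m k"
      and J2: "J2 = nadic_interval n (m + 1) j" "J2 \<subseteq> nadic_interval n m k"
      using nadic_child_cases[OF sib n] .
    define h where "h = 1 / real n powi (m + 1)"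
    have h: "h > 0" "1 / real n powi m = real n * h" using n by (auto simp: h_def power_int_add)
    define a c where "a = (of_int k - 1) / real n powi m" and "c = (of_int j - 1) / real n powi (m + 1)"
    have P: "nadic_interval n m k = {a..<a + real n * h}"
      unfolding nadic_interval_eq_Ico h(2) a_def ..
    have J2': "J2 = {c..<c + h}"
      unfolding J2(1) nadic_interval_eq_Ico h_def c_def ..
    have c: "a \<le> c" "c + h \<le> a + real n * h"
      using J2(2) h(1) unfolding J2' P by (auto simp: atLeastLessThan_subset_iff)
    have "(LINT x:J1|lebesgue. w x) \<le> (LINT x:{a..<a + real n * h}|lebesgue. w x)"
    proof (rule weight_integral_mono(3)[OF ws])
      show "J1 \<in> sets lebesgue" by (simp add: J1(1) nadic_interval_def)
      show "J1 \<subseteq> {a..<a + real n * h}" using J1(2) P by simp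
    qed
    also have "\<dots> \<le> 2 ^ M * (LINT x:{c..<c + h}|lebesgue. w x)"
    proof (rule mass_growth[OF ws c(1) _ c(2) M1 \<epsilon>])
      have "real n \<le> real M * \<epsilon>" using M \<epsilon> by (simp add: field_simps)
      then show "a + real n * h - a \<le> real M * (\<epsilon> * (c + h - c))"
        using mult_right_mono[of "real n" "real M * \<epsilon>" h] h by simp
      fix a' b' E
      assume *: "a \<le> a'" "a' < b'" "b' \<le> a + real n * h" "E \<in> sets lebesgue" "E \<subseteq> {a'..<b'}"
        "measure lebesgue E \<le> \<epsilon> * (b' - a')"
      \<comment> \<open>On the torus the parent has length at most 1, hence so do all intermediate
        intervals, which makes them admissible arcs.\<close>
      have "{a..<a + real n * h} \<in> intervals s"
        using I nadic_intervals_subset[OF n] P by auto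
      then have "s = Torus \<Longrightarrow> real n * h \<le> 1"
        unfolding intervals_def using h n by (auto simp: atLeastLessThan_eq_iff)
      then have "{a'..<b'} \<in> intervals s"
        using * unfolding intervals_def by (intro CollectI exI[of _ a'] exI[of _ b']) auto
      then show "(LINT x:E|lebesgue. w x) \<le> (LINT x:{a'..<b'}|lebesgue. w x) / 2"
        using small * by blast
    qed (use h in auto)
    finally show ?thesis by (simp add: J2')
  qed
  then show ?thesis unfolding nadic_doubling_def by blast
qed

section \<open>The fractional part as a weight\<close>

lemma frac_weight: "frac \<in> weights s"
  using locally_integrable_frac[of "\<lambda>x. x"] set_integral_id_Ico(1)[of 0 1] frac_function_on[of "\<lambda>x. x" s]
  by (simp add: weights_def)

text \<open>On a subinterval [a, b) of [0,1) the weight is bounded by \<open>b\<close>, and its mean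
  (a + b) / 2 is at least b / 2. The constant 2 therefore works for every exponent.\<close>

lemma frac_RH_nadic:
  assumes n: "n \<ge> 1" and q: "q > 1"
  shows "frac \<in> RH_over s (nadic_intervals s n) q"
proof -
  have p: "(\<lambda>x. x powr q) \<in> borel_measurable borel" "set_integrable lebesgue {0..<1} (\<lambda>x::real. x powr q)"
    using q by (auto intro!: set_integrable_bounded[where C=1] powr_le1 simp: measurable_completion)
  have *: "set_integrable lebesgue I (\<lambda>x. frac x powr q) \<and>
      avg I (\<lambda>x. frac x powr q) powr (1 / q) \<le> 2 * avg I frac"
    if I: "I \<in> nadic_intervals s n" for I
  proof -
    obtain a b where ab: "0 \<le> a" "a < b" "b \<le> (1::real)"
      and T: "\<And>g. g \<in> borel_measurable borel \<Longrightarrow> set_integrable lebesgue {0..<1} g \<Longrightarrow>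
        set_integrable lebesgue I (\<lambda>x. g (frac x)) \<and> avg I (\<lambda>x. g (frac x)) = avg {a..<b} g"
      using avg_nadic_frac[OF I n] by metis
    have pab: "set_integrable lebesgue {a..<b} (\<lambda>x::real. x powr q)"
      by (rule set_integrable_subset[OF p(2)]) (use ab in auto)
    have "avg {a..<b} (\<lambda>x. x powr q) \<le> avg {a..<b} (\<lambda>x. b powr q)"
      by (rule avg_mono[OF pab _ ab(2)]) (use ab q in \<open>auto intro!: powr_mono2\<close>)
    moreover have "0 \<le> avg {a..<b} (\<lambda>x. x powr q)"
      using avg_mono[OF _ pab ab(2), of "\<lambda>x. 0"] ab by (simp add: avg_const)
    ultimately have "avg {a..<b} (\<lambda>x. x powr q) powr (1 / q) \<le> (b powr q) powr (1 / q)"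
      using ab q by (intro powr_mono2) (auto simp: avg_const)
    also have "\<dots> = b" using ab q by (simp add: powr_powr)
    also have "\<dots> \<le> 2 * avg {a..<b} (\<lambda>x. x)" using ab by (simp add: avg_id)
    finally show ?thesis
      using T[OF p] T[of "\<lambda>x. x"] set_integral_id_Ico(1)[of 0 1] by simp
  qed
  then show ?thesis unfolding RH_over_def using frac_weight by blast
qed

text \<open>Siblings with integer endpoints contain equally many whole periods and have equal mass.
  Otherwise both lie in one cell, where the weight is the identity up to translation and masses are
  explicit.\<close>

lemma frac_doubling:
  assumes n: "n \<ge> 1" shows "nadic_doubling s n frac"
proof -
  have "(LINT x:J1|lebesgue. frac x) \<le> 2 * real n * (LINT x:J2|lebesgue. frac x)"
    if sib: "nadic_siblings s n J1 J2" for J1 J2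
  proof -
    obtain m k i j where I: "nadic_interval n m k \<in> nadic_intervals s n"
      and J1: "J1 = nadic_interval n (m + 1) i" "J1 \<subseteq> nadic_interval n m k"
      and J2: "J2 = nadic_interval n (m + 1) j" "J2 \<subseteq> nadic_interval n m k"
      using nadic_child_cases[OF sib n] .
    show ?thesis
    \<comment> \<open>The split is at the level of the children: in the second case m \<ge> 0, so
      the parent, and not only each child, lies in a single cell.\<close>
    proof (cases "m + 1 \<le> 0")
      case True
      obtain p1 where p1: "J1 = {of_int p1..<of_int p1 + real (n ^ nat (- (m + 1)))}"
        using nadic_interval_nonpos[OF n True] J1(1) by metis
      obtain p2 where p2: "J2 = {of_int p2..<of_int p2 + real (n ^ nat (- (m + 1)))}"
        using nadic_interval_nonpos[OF n True] J2(1) by metis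
      have "(LINT x:J1|lebesgue. frac x) = (LINT x:J2|lebesgue. frac x)"
        unfolding p1 p2 using set_integral_id_Ico(1)[of 0 1]
        by (subst (1 2) set_integral_periodic(2)[where g="\<lambda>x. x"]) auto
      moreover have "0 \<le> (LINT x:J2|lebesgue. frac x)"
        unfolding p2 by (rule weight_integral_mono(2)[OF frac_weight _ order_refl]) simp
      ultimately show ?thesis
        using n mult_right_mono[of 1 "2 * real n" "LINT x:J2|lebesgue. frac x"] by simp
    next
      case False
      define N where "N = n ^ nat m"
      have N: "N \<ge> 1" using n by (simp add: N_def)
      obtain i' j' where ij: "i' < N"
        "nadic_interval n m k = {real i' / real N + of_int j'..<real (Suc i') / real N + of_int j'}"
        using nadic_interval_nonneg[OF n, of m k] False by (auto simp: N_def)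
      have pw: "real n powi m = real N" using False by (simp add: N_def power_int_def)
      define h where "h = 1 / (real N * real n)"
      have h: "h > 0" "1 / real N = real n * h" "1 / real n powi (m + 1) = h"
        using n N by (auto simp: h_def power_int_add pw)
      define a where "a = real i' / real N"
      have a: "0 \<le> a" "a + real n * h \<le> 1"
        using ij(1) N unfolding h(2)[symmetric] a_def by (auto simp: field_simps)
      have P: "nadic_interval n m k = {a + of_int j'..<a + real n * h + of_int j'}"
        unfolding ij(2) h(2)[symmetric] a_def by (simp add: add_divide_distrib add.commute)
      define c1 c2 where "c1 = (of_int i - 1) / real n powi (m + 1) - of_int j'"
        and "c2 = (of_int j - 1) / real n powi (m + 1) - of_int j'"
      have J1': "J1 = {c1 + of_int j'..<(c1 + h) + of_int j'}"
        unfolding J1(1) nadic_interval_eq_Ico h(3) c1_def by simp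
      have J2': "J2 = {c2 + of_int j'..<(c2 + h) + of_int j'}"
        unfolding J2(1) nadic_interval_eq_Ico h(3) c2_def by simp
      have c1: "a \<le> c1" "c1 + h \<le> a + real n * h"
        using J1(2) h(1) unfolding J1' P by (auto simp: atLeastLessThan_subset_iff)
      have c2: "a \<le> c2" "c2 + h \<le> a + real n * h"
        using J2(2) h(1) unfolding J2' P by (auto simp: atLeastLessThan_subset_iff)
      have eq: "(LINT x:{c + of_int j'..<(c + h) + of_int j'}|lebesgue. frac x) = h * (c + h / 2)"
        if c: "a \<le> c" "c + h \<le> a + real n * h" for c
      proof -
        have "(LINT x:{c + of_int j'..<(c + h) + of_int j'}|lebesgue. frac x) =
            (LINT x:{c..<c + h}|lebesgue. frac (x + of_int j'))"
          by (rule set_integral_Ico_shift(2)) simp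
        also have "\<dots> = (LINT x:{c..<c + h}|lebesgue. x)"
          using a c by (intro set_lebesgue_integral_cong) auto
        also have "\<dots> = h * (c + h / 2)"
          using a c h by (subst set_integral_id_Ico) (auto simp: power2_eq_square algebra_simps)
        finally show ?thesis .
      qed
      \<comment> \<open>The averages over both children lie between a + h / 2 and a + n h, and the
        larger of these is at most 2n times the smaller.\<close>
      have "c1 + h / 2 \<le> a + real n * h" using c1 h by simp
      also have "\<dots> \<le> 2 * real n * a + 2 * real n * (h / 2)"
        using mult_right_mono[of 1 "2 * real n" a] n a by simp
      also have "\<dots> \<le> 2 * real n * (c2 + h / 2)"
        using c2(1) n by (simp add: distrib_left mult_left_mono)
      finally have "h * (c1 + h / 2) \<le> h * (2 * real n * (c2 + h / 2))"
        using h by (intro mult_left_mono) auto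
      then show ?thesis unfolding J1' J2' eq[OF c1] eq[OF c2] by (simp add: algebra_simps)
    qed
  qed
  then show ?thesis unfolding nadic_doubling_def by blast
qed

text \<open>The contradiction is with the uniform absolute continuity of
  \<open>RH_small_subset\<close>: left of 0 a very short piece has mass comparable to its length
  \<open>u\<close>, whereas [0, t) has only mass t^2 / 2.\<close>

lemma frac_not_RH:
  assumes q: "q > 1" shows "frac \<notin> RH_over s (intervals s) q"
proof
  assume "frac \<in> RH_over s (intervals s) q"
  then obtain \<epsilon> where \<epsilon>: "\<epsilon> > 0" and small: "\<And>a b E. {a..<b} \<in> intervals s \<Longrightarrow> a < b \<Longrightarrow>
      E \<in> sets lebesgue \<Longrightarrow> E \<subseteq> {a..<b} \<Longrightarrow> measure lebesgue E \<le> \<epsilon> * (b - a) \<Longrightarrow>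
      (LINT x:E|lebesgue. frac x) \<le> (LINT x:{a..<b}|lebesgue. frac x) / 2"
    using RH_small_subset[OF _ q] by metis
  \<comment> \<open>With u = \<sigma> t, the bound \<sigma> \<le> \<epsilon> makes [-u, 0) a small
    enough part of [-u, t), which forces u \<le> t^2; but t < \<sigma> gives u > t^2.\<close>
  define \<sigma> where "\<sigma> = min \<epsilon> (1/4)"
  define t where "t = \<sigma> / 2"
  have \<sigma>: "0 < \<sigma>" "\<sigma> \<le> \<epsilon>" "\<sigma> \<le> 1/4" using \<epsilon> by (auto simp: \<sigma>_def)
  have t: "0 < t" "t < \<sigma>" using \<sigma> by (auto simp: t_def)
  define u where "u = \<sigma> * t"
  have u: "0 < u" "u \<le> 1/2" "u + t \<le> 1" using \<sigma> t mult_mono[of \<sigma> "1/4" t "1/4"] by (auto simp: u_def)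
  note loc = locally_integrable_frac[of "\<lambda>x. x", OF _ set_integral_id_Ico(1)[of 0 1]]
  have fi: "set_integrable lebesgue {a..<b} (frac :: real \<Rightarrow> real)" for a b
    using locally_integrable_Ico[OF loc] by simp
  have "(LINT x:{-u..<0}|lebesgue. frac x) \<le> (LINT x:{-u..<t}|lebesgue. frac x) / 2"
  proof (rule small)
    show "{-u..<t} \<in> intervals s"
      unfolding intervals_def using u t by (intro CollectI exI[of _ "-u"] exI[of _ t]) auto
    have "u \<le> \<epsilon> * t" unfolding u_def using \<sigma> t by (intro mult_right_mono) auto
    also have "\<dots> \<le> \<epsilon> * (t + u)" using \<epsilon> u by (intro mult_left_mono) auto
    finally show "measure lebesgue {-u..<0} \<le> \<epsilon> * (t - - u)" using u by simp
  qed (use u t in auto)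
  moreover have "(LINT x:{-u..<t}|lebesgue. frac x) =
      (LINT x:{-u..<0}|lebesgue. frac x) + (LINT x:{0..<t}|lebesgue. frac x)"
  proof -
    have "{-u..<t} = {-u..<0} \<union> {0..<t}" using u t by auto
    then show ?thesis using set_integral_Un[of "{-u..<0}" "{0..<t}" lebesgue frac] fi by auto
  qed
  moreover have "(LINT x:{0..<t}|lebesgue. frac x) = t\<^sup>2 / 2"
  proof -
    have "(LINT x:{0..<t}|lebesgue. frac x) = (LINT x:{0..<t}|lebesgue. x)"
      using t \<sigma> by (intro set_lebesgue_integral_cong) auto
    then show ?thesis using set_integral_id_Ico(2)[of 0 t] t by simp
  qed
  moreover have "u / 2 \<le> (LINT x:{-u..<0}|lebesgue. frac x)"
  proof -
    have "avg {-u..<0} (\<lambda>x. 1/2) \<le> avg {-u..<0} frac"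
      by (rule avg_mono) (use u fi in \<open>auto simp: frac_neg_eq\<close>)
    then show ?thesis using u by (simp add: avg_const avg_Ico field_simps)
  qed
  ultimately have "u \<le> t * t" by (simp add: power2_eq_square)
  then show False using t by (simp add: u_def)
qed

lemma RH_strict:
  assumes "1 \<le> r" shows "RH s r \<subset> (\<Inter>n\<in>{2..}. RH_nadic s n r)"
proof (rule psubsetI)
  have sub: "RH_over s (intervals s) q \<subseteq> RH_over s (nadic_intervals s n) q \<inter> {w. nadic_doubling s n w}"
    if "n \<ge> 2" "q > 1" for n q
    using that RH_over_antimono[OF nadic_intervals_subset[of n s], of s q] RH_doubling[of _ s q n] by auto
  show "RH s r \<subseteq> (\<Inter>n\<in>{2..}. RH_nadic s n r)"
  proof (intro INF_greatest)
    fix n :: nat assume "n \<in> {2..}"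
    then show "RH s r \<subseteq> RH_nadic s n r"
      unfolding RH_def RH_nadic_def using sub[of n] assms
      by (cases "r = 1") (force, force)
  qed
  have "frac \<in> RH_nadic s n r" if "n \<ge> 2" for n
    using assms that frac_RH_nadic[of n _ s] frac_doubling[of n s]
    by (cases "r = 1") (auto simp: RH_nadic_def gt_ex)
  moreover have "frac \<notin> RH s r"
    using assms frac_not_RH[of _ s] by (auto simp: RH_def)
  ultimately show "RH s r \<noteq> (\<Inter>n\<in>{2..}. RH_nadic s n r)" by auto
qed

subsection \<open>Hardy spaces\<close>

lemma set_integrable_mult_bounded:
  fixes f g :: "real \<Rightarrow> real"
  assumes f: "set_integrable lebesgue D f" and g: "g \<in> borel_measurable lebesgue" "\<And>x. \<bar>g x\<bar> \<le> B"
  shows "set_integrable lebesgue D (\<lambda>x. f x * g x)"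
    and "\<bar>LINT x:D|lebesgue. f x * g x\<bar> \<le> B * (LINT x:D|lebesgue. \<bar>f x\<bar>)"
proof -
  have int: "integrable lebesgue (\<lambda>x. indicator D x *\<^sub>R f x)" using f by (simp add: set_integrable_def)
  have B: "B \<ge> 0" using g(2)[of 0] by linarith
  have "integrable lebesgue (\<lambda>x. (indicator D x *\<^sub>R f x) * g x)"
  proof (rule Bochner_Integration.integrable_bound)
    show "integrable lebesgue (\<lambda>x. B * (indicator D x *\<^sub>R f x))" using int by (rule integrable_mult_right)
    show "(\<lambda>x. (indicator D x *\<^sub>R f x) * g x) \<in> borel_measurable lebesgue"
      using borel_measurable_integrable[OF int] g(1) by (rule borel_measurable_times)
    show "AE x in lebesgue. norm ((indicator D x *\<^sub>R f x) * g x) \<le> norm (B * (indicator D x *\<^sub>R f x))"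
      using g(2) B by (auto simp: abs_mult mult.commute[of B] intro!: mult_left_mono AE_I2)
  qed
  then show fg: "set_integrable lebesgue D (\<lambda>x. f x * g x)"
    by (simp add: set_integrable_def mult.assoc)
  have "\<bar>LINT x:D|lebesgue. f x * g x\<bar> \<le> (LINT x:D|lebesgue. \<bar>f x * g x\<bar>)"
    using fg unfolding set_lebesgue_integral_def set_integrable_def
    by (intro order_trans[OF integral_abs_bound]) (auto simp: abs_mult intro!: integral_mono)
  also have "\<dots> \<le> (LINT x:D|lebesgue. B * \<bar>f x\<bar>)"
  proof (rule set_integral_mono)
    show "set_integrable lebesgue D (\<lambda>x. \<bar>f x * g x\<bar>)" by (rule set_integrable_abs[OF fg])
    show "set_integrable lebesgue D (\<lambda>x. B * \<bar>f x\<bar>)"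
      using set_integrable_abs[OF f] by (intro set_integrable_mult_right) auto
    show "\<bar>f x * g x\<bar> \<le> B * \<bar>f x\<bar>" for x
      using mult_right_mono[OF g(2)[of x], of "\<bar>f x\<bar>"] by (simp add: abs_mult mult.commute)
  qed
  finally show "\<bar>LINT x:D|lebesgue. f x * g x\<bar> \<le> B * (LINT x:D|lebesgue. \<bar>f x\<bar>)" by simp
qed

lemma atom_integrable:
  assumes "I \<in> intervals s" "atom s I a"
  shows "set_integrable lebesgue (fundamental_domain s) a"
proof -
  obtain c d where I: "I = {c..<d}" using assms by (auto simp: intervals_def)
  have a: "a \<in> borel_measurable lebesgue" "\<And>x. \<bar>a x\<bar> \<le> 1 / measure lebesgue I"
    using assms by (auto simp: atom_def)
  show ?thesis
  proof (cases s)
    case Torus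
    then show ?thesis using a by (auto simp: fundamental_domain_def intro: set_integrable_bounded)
  next
    case Line
    have "a x = indicator I x * a x" for x
      using assms Line by (auto simp: atom_def saturation_def indicator_def)
    then have "a = (\<lambda>x. indicator I x *\<^sub>R a x)" by auto
    moreover have "set_integrable lebesgue I a"
      unfolding I by (rule set_integrable_bounded) (use a in auto)
    ultimately show ?thesis using Line by (simp add: fundamental_domain_def set_integrable_def)
  qed
qed

text \<open>\<open>S\<close> is the sum of the absolute coefficients of one atomic decomposition of
  \<open>f\<close>, chosen before \<open>g\<close>. The sup bound \<open>B\<close> multiplies only
  the L1 error of the partial sums and disappears in the limit, so one \<open>S\<close> serves a
  family of test functions with growing sup norms.\<close>

lemma H1_pairing_bound:
  assumes f: "f \<in> H1_over s F" and F: "F \<subseteq> intervals s"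
  shows "\<exists>S. \<forall>g B M. g \<in> borel_measurable lebesgue \<longrightarrow> (\<forall>x. \<bar>g x\<bar> \<le> B) \<longrightarrow> M \<ge> 0 \<longrightarrow>
    (\<forall>I\<in>F. \<forall>a. atom s I a \<longrightarrow> \<bar>LINT x:fundamental_domain s|lebesgue. a x * g x\<bar> \<le> M) \<longrightarrow>
    \<bar>LINT x:fundamental_domain s|lebesgue. f x * g x\<bar> \<le> M * S"
proof -
  let ?D = "fundamental_domain s"
  obtain c :: "nat \<Rightarrow> real" and a :: "nat \<Rightarrow> real \<Rightarrow> real" where
      c: "summable (\<lambda>j. \<bar>c j\<bar>)" and a: "\<And>j. \<exists>I\<in>F. atom s I (a j)"
      and lim: "(\<lambda>N. LINT x:?D|lebesgue. \<bar>f x - (\<Sum>j<N. c j * a j x)\<bar>) \<longlonglongrightarrow> 0"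
      and fint: "set_integrable lebesgue ?D f"
    using f unfolding H1_over_def by blast
  show ?thesis
  proof (intro exI allI impI)
    fix g :: "real \<Rightarrow> real" and B M :: real
    assume g: "g \<in> borel_measurable lebesgue" and "\<forall>x. \<bar>g x\<bar> \<le> B" and M: "M \<ge> 0"
      and "\<forall>I\<in>F. \<forall>a. atom s I a \<longrightarrow> \<bar>LINT x:?D|lebesgue. a x * g x\<bar> \<le> M"
    then have bound: "\<And>I a. I \<in> F \<Longrightarrow> atom s I a \<Longrightarrow> \<bar>LINT x:?D|lebesgue. a x * g x\<bar> \<le> M"
      and gB: "\<And>x. \<bar>g x\<bar> \<le> B" by auto
    note g = g gB
    have aint: "set_integrable lebesgue ?D (a j)" for j
      using a[of j] F atom_integrable by blast
    have cint: "set_integrable lebesgue ?D (\<lambda>x. c j * a j x)" for j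
      using aint by (intro set_integrable_mult_right) auto
    have "\<bar>LINT x:?D|lebesgue. f x * g x\<bar> \<le>
      B * (LINT x:?D|lebesgue. \<bar>f x - (\<Sum>j<N. c j * a j x)\<bar>) + M * (\<Sum>j. \<bar>c j\<bar>)" for N
    proof -
      let ?S = "\<lambda>x. \<Sum>j<N. c j * a j x"
      have Sint: "set_integrable lebesgue ?D ?S"
        unfolding set_integrable_def scaleR_sum_right
        using cint by (intro Bochner_Integration.integrable_sum) (simp only: set_integrable_def)
      have dint: "set_integrable lebesgue ?D (\<lambda>x. f x - ?S x)"
        by (rule set_integral_diff(1)[OF fint Sint])
      have "(LINT x:?D|lebesgue. ?S x * g x) = (\<Sum>j<N. c j * (LINT x:?D|lebesgue. a j x * g x))"
      proof -
        have "(LINT x:?D|lebesgue. ?S x * g x) =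
            (LINT x|lebesgue. (\<Sum>j<N. c j * (indicator ?D x *\<^sub>R (a j x * g x))))"
          by (simp add: set_lebesgue_integral_def sum_distrib_left sum_distrib_right mult_ac)
        also have "\<dots> = (\<Sum>j<N. LINT x|lebesgue. c j * (indicator ?D x *\<^sub>R (a j x * g x)))"
          using set_integrable_mult_bounded(1)[OF aint g]
          by (intro Bochner_Integration.integral_sum integrable_mult_right) (simp add: set_integrable_def)
        finally show ?thesis by (simp add: set_lebesgue_integral_def)
      qed
      also have "\<bar>\<dots>\<bar> \<le> (\<Sum>j<N. \<bar>c j * (LINT x:?D|lebesgue. a j x * g x)\<bar>)" by (rule sum_abs)
      also have "\<dots> \<le> (\<Sum>j<N. \<bar>c j\<bar> * M)"
        using a bound unfolding abs_mult by (intro sum_mono mult_left_mono) (blast, simp)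
      also have "\<dots> = M * (\<Sum>j<N. \<bar>c j\<bar>)" by (simp add: sum_distrib_left mult.commute)
      also have "\<dots> \<le> M * (\<Sum>j. \<bar>c j\<bar>)"
        using M c by (intro mult_left_mono sum_le_suminf) auto
      finally have 1: "\<bar>LINT x:?D|lebesgue. ?S x * g x\<bar> \<le> M * (\<Sum>j. \<bar>c j\<bar>)" .
      have "(LINT x:?D|lebesgue. f x * g x) =
          (LINT x:?D|lebesgue. (f x - ?S x) * g x + ?S x * g x)"
        by (simp add: algebra_simps)
      also have "\<dots> = (LINT x:?D|lebesgue. (f x - ?S x) * g x) + (LINT x:?D|lebesgue. ?S x * g x)"
        by (rule set_integral_add(2)) (rule set_integrable_mult_bounded(1)[OF dint g] set_integrable_mult_bounded(1)[OF Sint g])+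
      finally show ?thesis
        using 1 set_integrable_mult_bounded(2)[OF dint g] by linarith
    qed
    moreover have "(\<lambda>N. B * (LINT x:?D|lebesgue. \<bar>f x - (\<Sum>j<N. c j * a j x)\<bar>) + M * (\<Sum>j. \<bar>c j\<bar>))
        \<longlonglongrightarrow> B * 0 + M * (\<Sum>j. \<bar>c j\<bar>)"
      by (intro tendsto_intros lim)
    ultimately show "\<bar>LINT x:?D|lebesgue. f x * g x\<bar> \<le> M * (\<Sum>j. \<bar>c j\<bar>)"
      by (auto intro: LIMSEQ_le_const)
  qed
qed

lemma atom_in_H1:
  assumes "I \<in> intervals s" "atom s I a" shows "a \<in> H1 s"
proof -
  define c where "c j = (if j = 0 then 1 else 0 :: real)" for j :: nat
  have "summable (\<lambda>j. \<bar>c j\<bar>)"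
    by (rule summable_finite[of "{0}"]) (auto simp: c_def)
  moreover have "(\<lambda>N. LINT x:fundamental_domain s|lebesgue. \<bar>a x - (\<Sum>j<N. c j * a x)\<bar>) \<longlonglongrightarrow> 0"
  proof (rule tendsto_eventually)
    show "\<forall>\<^sub>F N in sequentially. (LINT x:fundamental_domain s|lebesgue. \<bar>a x - (\<Sum>j<N. c j * a x)\<bar>) = 0"
      using eventually_gt_at_top[of 0]
    proof eventually_elim
      case (elim N)
      then have "(\<Sum>j<N. c j * a x) = a x" for x
        by (simp add: sum_distrib_right[symmetric] c_def)
      then show ?case by (simp add: set_lebesgue_integral_def)
    qed
  qed
  ultimately show ?thesis
    unfolding H1_def H1_over_def using assms atom_integrable[OF assms]
    by (auto simp: atom_def intro!: exI[of _ c] exI[of _ "\<lambda>_. a"])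
qed

section \<open>The witness on the line\<close>

text \<open>The test function is the indicator of the positive half-line. A dyadic interval lies on
  one side of 0, so every dyadic atom pairs to 0 with it, while the witness pairs to 1/2.\<close>

lemma H1_Line_witness: "\<exists>f \<in> H1 Line. f \<notin> H1_nadic Line 2"
proof (rule bexI)
  define f :: "real \<Rightarrow> real" where "f x = indicator {0..<1/2} x - indicator {-1/2..<0} x" for x
  have fD: "fundamental_domain Line = UNIV" by (simp add: fundamental_domain_def)
  have int: "integrable lebesgue (indicator {a..<b} :: real \<Rightarrow> real)" if "a \<le> b" for a b :: real
    using that by (intro integrable_real_indicator) auto
  have f: "f = (\<lambda>x. indicator {0..<1/2} x - indicator {-1/2..<0} x)" by (auto simp: f_def)
  have "f \<in> borel_measurable borel" unfolding f by measurable
  then have "f \<in> borel_measurable lebesgue" by (simp add: measurable_completion)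
  moreover have "(LINT x|lebesgue. f x) = 0"
    unfolding f_def by (subst Bochner_Integration.integral_diff) (auto intro!: int)
  moreover have "{x. f x \<noteq> 0} \<subseteq> {-1/2..<1/2}" "\<And>x. \<bar>f x\<bar> \<le> 1"
    by (auto simp: f_def indicator_def split: if_splits)
  ultimately have "atom Line {-1/2..<1/2} f"
    unfolding atom_def by (simp add: functions_on_def saturation_def fD set_lebesgue_integral_def)
  then show "f \<in> H1 Line"
    by (rule atom_in_H1[rotated]) (use centered_interval[of "1/2" Line] in simp)
  show "f \<notin> H1_nadic Line 2"
  proof
    assume "f \<in> H1_nadic Line 2"
    then have f2: "f \<in> H1_over Line (nadic_intervals Line 2)" by (simp add: H1_nadic_def)
    obtain S where S: "\<forall>g B M. g \<in> borel_measurable lebesgue \<longrightarrow> (\<forall>x. \<bar>g x\<bar> \<le> B) \<longrightarrow> M \<ge> 0 \<longrightarrow>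
      (\<forall>I\<in>nadic_intervals Line 2. \<forall>a. atom Line I a \<longrightarrow>
        \<bar>LINT x:UNIV|lebesgue. a x * g x\<bar> \<le> M) \<longrightarrow>
      \<bar>LINT x:UNIV|lebesgue. f x * g x\<bar> \<le> M * S"
      using H1_pairing_bound[OF f2 nadic_intervals_subset[OF one_le_numeral], unfolded fD] by blast
    define g where "g = (indicator {0..} :: real \<Rightarrow> real)"
    have "\<bar>LINT x:UNIV|lebesgue. a x * g x\<bar> \<le> 0" if I: "I \<in> nadic_intervals Line 2" and a: "atom Line I a" for I a
    proof -
      obtain m k where mk: "I = nadic_interval 2 m k" using I by (auto simp: nadic_intervals_def)
      have supp: "a x = 0" if "x \<notin> I" for x using a that by (auto simp: atom_def saturation_def)
      have zero: "(LINT x:UNIV|lebesgue. a x) = 0" using a by (simp add: atom_def fD)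
      have p: "(2::real) powi m > 0" by simp
      show ?thesis
      proof (cases "k \<ge> 1")
        case True
        then have "0 \<le> (real_of_int k - 1) / 2 powi m" using p by simp
        then have "x \<in> I \<Longrightarrow> x \<ge> 0" for x by (auto simp: mk nadic_interval_def)
        then have "(\<lambda>x. a x * g x) = a" using supp by (force simp: g_def indicator_def)
        then show ?thesis using zero by simp
      next
        case False
        then have "real_of_int k / 2 powi m \<le> 0" using p by (simp add: divide_le_0_iff)
        then have neg: "x \<in> I \<Longrightarrow> x < 0" for x by (auto simp: mk nadic_interval_def)
        have "a x * g x = 0" for x using supp[of x] neg[of x] by (cases "x \<in> I") (auto simp: g_def indicator_def)
        then have eq: "(\<lambda>x. a x * g x) = (\<lambda>x. 0)" by (rule ext)
        show ?thesis unfolding eq by (simp add: set_lebesgue_integral_def)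
      qed
    qed
    \<comment> \<open>The atomic bound is M = 0, so the unknown size of \<open>S\<close> does not
      matter.\<close>
    then have "\<bar>LINT x:UNIV|lebesgue. f x * g x\<bar> \<le> 0 * S"
      by (intro S[rule_format, of g 1 0]) (auto simp: g_def intro!: borel_measurable_indicator)
    moreover have "f x * g x = indicator {0..<1/2} x" for x by (auto simp: f_def g_def indicator_def)
    ultimately show False by (simp add: set_lebesgue_integral_def)
  qed
qed

section \<open>The witness on the circle\<close>

text \<open>For k \<ge> 1 this is an odd function, up to endpoints, on the arc from -2^(-k) to
  2^(-k); its height is the reciprocal of the arc length 2^(1-k), and \<open>frac\<close> makes it
  periodic.\<close>

definition circle_atom :: "nat \<Rightarrow> real \<Rightarrow> real" where
  "circle_atom k x = 2 ^ (k - 1) * (indicator {0..<1 / 2 ^ k} (frac x) - indicator {1 - 1 / 2 ^ k..<1} (frac x))"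

lemma inv_power2_le_half: "k \<ge> 1 \<Longrightarrow> 1 / 2 ^ k \<le> (1 / 2 :: real)"
  using power_decreasing[of 1 k "1/2 :: real"] by (simp add: power_one_over)

lemma borel_measurable_circle_atom [measurable]: "circle_atom k \<in> borel_measurable borel"
  unfolding circle_atom_def by measurable

lemma circle_atom_bound: "\<bar>circle_atom k x\<bar> \<le> 2 ^ (k - 1)"
  by (auto simp: circle_atom_def abs_mult indicator_def)

lemma circle_atom_nonneg:
  assumes "k \<ge> 1" "0 \<le> x" "x < 1/2" shows "0 \<le> circle_atom k x"
  using inv_power2_le_half[OF assms(1)] assms by (auto simp: circle_atom_def indicator_def)

lemma circle_atom_atom:
  assumes k: "k \<ge> 1"
  shows "{-1 / 2 ^ k..<1 / 2 ^ k} \<in> intervals Torus" "atom Torus {-1 / 2 ^ k..<1 / 2 ^ k} (circle_atom k)"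
proof -
  define e :: real where "e = 1 / 2 ^ k"
  have e: "0 < e" "e \<le> 1/2" using inv_power2_le_half[OF k] by (auto simp: e_def)
  have me: "1 / (2 * e) = 2 ^ (k - 1)" using k by (cases k) (auto simp: e_def)
  show "{-1 / 2 ^ k..<1 / 2 ^ k} \<in> intervals Torus"
    using centered_interval[OF e] by (simp add: e_def)
  have supp: "x \<in> saturation Torus {-e..<e}" if "circle_atom k x \<noteq> 0" for x
  proof -
    have "frac x \<in> {0..<e} \<or> frac x \<in> {1 - e..<1}"
      using that by (auto simp: circle_atom_def e_def indicator_def split: if_splits)
    then have "\<exists>y j. x = y + of_int j \<and> y \<in> {-e..<e}"
    proof
      assume "frac x \<in> {0..<e}"
      moreover have "-e \<le> frac x" using e frac_ge_0[of x] by linarith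
      ultimately show ?thesis
        using e by (intro exI[of _ "frac x"] exI[of _ "\<lfloor>x\<rfloor>"]) (auto simp: frac_def)
    next
      assume "frac x \<in> {1 - e..<1}"
      then show ?thesis
        using e by (intro exI[of _ "frac x - 1"] exI[of _ "\<lfloor>x\<rfloor> + 1"]) (auto simp: frac_def)
    qed
    then show ?thesis by (auto simp: saturation_def)
  qed
  have "(LINT x:{0..<1}|lebesgue. circle_atom k x) =
      (LINT x|lebesgue. 2 ^ (k - 1) * (indicator {0..<e} x - indicator {1 - e..<1} x))"
    unfolding set_lebesgue_integral_def
    using e by (intro Bochner_Integration.integral_cong) (auto simp: circle_atom_def e_def[symmetric] indicator_def)
  also have "\<dots> = 2 ^ (k - 1) * ((LINT x|lebesgue. indicator {0..<e} x) - (LINT x|lebesgue. indicator {1 - e..<1} x))"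
    using e by (subst integral_mult_right_zero, subst Bochner_Integration.integral_diff)
      (auto intro!: integrable_real_indicator)
  also have "\<dots> = 0" using e by simp
  finally have "(LINT x:{0..<1}|lebesgue. circle_atom k x) = 0" .
  moreover have "circle_atom k (x + 1) = circle_atom k x" for x
    by (simp add: circle_atom_def frac_1_eq)
  moreover have "\<bar>circle_atom k x\<bar> \<le> 1 / measure lebesgue {-e..<e}" for x
    using circle_atom_bound[of k x] e me by simp
  ultimately have "atom Torus {-e..<e} (circle_atom k)"
    using supp by (auto simp: atom_def functions_on_def fundamental_domain_def measurable_completion)
  then show "atom Torus {-1 / 2 ^ k..<1 / 2 ^ k} (circle_atom k)" by (simp add: e_def)
qed

lemma circle_atom_L1:
  assumes k: "k \<ge> 1" shows "(LINT x:{0..<1}|lebesgue. \<bar>circle_atom k x\<bar>) \<le> 1"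
proof -
  define e :: real where "e = 1 / 2 ^ k"
  have e: "0 < e" "e \<le> 1/2" using inv_power2_le_half[OF k] by (auto simp: e_def)
  have me: "2 ^ (k - 1) * (2 * e) = 1" using k by (cases k) (auto simp: e_def)
  have "(LINT x:{0..<1}|lebesgue. \<bar>circle_atom k x\<bar>) =
      (LINT x|lebesgue. 2 ^ (k - 1) * (indicator {0..<e} x + indicator {1 - e..<1} x))"
    unfolding set_lebesgue_integral_def
    using e by (intro Bochner_Integration.integral_cong)
      (auto simp: circle_atom_def e_def[symmetric] indicator_def abs_mult)
  also have "\<dots> = 2 ^ (k - 1) * ((LINT x|lebesgue. indicator {0..<e} x) + (LINT x|lebesgue. indicator {1 - e..<1} x))"
    using e by (subst integral_mult_right_zero, subst Bochner_Integration.integral_add)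
      (auto intro!: integrable_real_indicator)
  also have "\<dots> = 1" using e me by simp
  finally show ?thesis by simp
qed

text \<open>For x in (0,1) this counts the j in 1..N with j < - log2 x, a truncated logarithm. Its
  jumps sit at dyadic points, which is what makes atoms on dyadic intervals cancel against the
  coarse steps.\<close>

definition log_step :: "nat \<Rightarrow> real \<Rightarrow> real" where
  "log_step N x = (\<Sum>j = 1..N. indicator {0..<1 / 2 ^ j} x)"

text \<open>The exact remainder is kept on the right so that the induction closes; truncated
  subtraction makes it 1 - 1 as long as N \<le> m.\<close>

lemma sum_dyadic_tail:
  "(\<Sum>j = 1..N. if j \<le> m then 0 else 2 ^ m / 2 ^ j) \<le> (1 - (1/2) ^ (N - m) :: real)"
proof (induction N)
  case (Suc N)
  show ?case
  proof (cases "Suc N \<le> m")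
    case True
    then show ?thesis using Suc by simp
  next
    case False
    then obtain d where "N = m + d" by (metis le_add_diff_inverse not_less_eq_eq)
    moreover have "2 ^ m / 2 ^ Suc (m + d) = (1/2 :: real) ^ d / 2"
      by (simp add: power_add power_one_over)
    ultimately show ?thesis using Suc False by (simp add: Suc_diff_le)
  qed
qed simp

text \<open>Let the interval have length 2^(-M). A step with j \<le> M is constant on it and is
  killed by the mean-zero condition; one with j > M contributes at most the height 2^M times the
  length 2^(-j). The geometric series gives 1, uniformly in \<open>N\<close>.\<close>

lemma log_step_atom:
  assumes I: "I \<in> nadic_intervals Torus 2" and a: "atom Torus I a"
  shows "\<bar>LINT x:{0..<1}|lebesgue. a x * log_step N x\<bar> \<le> 1"
proof -
  obtain m k where mk: "I = nadic_interval 2 m k" and sub: "I \<subseteq> {0..<1}"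
    using I by (auto simp: nadic_intervals_def)
  have zero: "(LINT x:{0..<1}|lebesgue. a x) = 0" using a by (simp add: atom_def fundamental_domain_def)
  have aint: "set_integrable lebesgue {0..<1} a"
    using atom_integrable[OF _ a] I nadic_intervals_subset[of 2 Torus] by (auto simp: fundamental_domain_def)
  \<comment> \<open>Since the interval already lies in [0,1), no other integer translate of it meets
    [0,1).\<close>
  have supp: "a x = 0" if "x \<in> {0..<1}" "x \<notin> I" for x
  proof (rule ccontr)
    assume "a x \<noteq> 0"
    then obtain y j where y: "x = y + of_int j" "y \<in> I"
      using a by (auto simp: atom_def saturation_def)
    then have "frac y = y" "frac x = x" using sub that by auto
    then have "x = y" using y(1) by (metis frac_add_of_int_right)
    then show False using y that by simp
  qed
  have p: "(2::real) powi m > 0" by simp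
  have len: "measure lebesgue I = 1 / 2 powi m"
    by (simp add: mk nadic_interval_def diff_divide_distrib)
  have "m \<ge> 0"
  proof (rule ccontr)
    assume "\<not> m \<ge> 0"
    then have "(2::real) powi m < 1" using power_int_strict_increasing[of m 0 "2::real"] by simp
    then have "1 / 2 powi m > (1::real)" using p by simp
    moreover have "1 / 2 powi m \<le> (1::real)"
      using measure_mono_fmeasurable[OF sub, of lebesgue] unfolding len
      by (simp add: mk nadic_interval_def fmeasurable_def)
    ultimately show False by simp
  qed
  define M where "M = nat m"
  have pM: "(2::real) powi m = 2 ^ M" using \<open>m \<ge> 0\<close> by (simp add: M_def power_int_def)
  have I': "I = {(of_int k - 1) / 2 ^ M..<of_int k / 2 ^ M}" by (simp add: mk nadic_interval_def pM)
  have abound: "\<bar>a x\<bar> \<le> 2 ^ M" for x using a by (simp add: atom_def len pM)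
  have iint: "set_integrable lebesgue {0..<1} (\<lambda>x. a x * indicator {0..<1 / 2 ^ j} x)" for j :: nat
    by (rule set_integrable_mult_bounded(1)[OF aint, of _ 1]) (auto intro!: borel_measurable_indicator)
  have each: "\<bar>LINT x:{0..<1}|lebesgue. a x * indicator {0..<1 / 2 ^ j} x\<bar> \<le>
      (if j \<le> M then 0 else 2 ^ M / 2 ^ j)" for j :: nat
  proof (cases "j \<le> M")
    case True
    \<comment> \<open>The edge of the step is a multiple of 2^(-M), so the interval is either
      contained in [0, 2^(-j)) or disjoint from it, depending on \<open>k\<close>.\<close>
    have eq: "1 / 2 ^ j = real_of_int (2 ^ (M - j)) / 2 ^ M"
    proof -
      have "(2::real) ^ M = 2 ^ j * 2 ^ (M - j)" using True by (simp flip: power_add)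
      then show ?thesis by simp
    qed
    show ?thesis
    proof (cases "k \<le> 2 ^ (M - j)")
      case k: True
      then have "real_of_int k / 2 ^ M \<le> 1 / 2 ^ j"
        unfolding eq by (intro divide_right_mono) (auto simp del: of_int_power)
      then have "I \<subseteq> {0..<1 / 2 ^ j}" using sub by (auto simp: I')
      then have "a x * indicator {0..<1 / 2 ^ j} x = a x" if "x \<in> {0..<1}" for x
        using that supp[of x] by (cases "x \<in> I") (auto simp: indicator_def)
      then have "(LINT x:{0..<1}|lebesgue. a x * indicator {0..<1 / 2 ^ j} x) = (LINT x:{0..<1}|lebesgue. a x)"
        by (intro set_lebesgue_integral_cong) auto
      then show ?thesis using zero by simp
    next
      case k: False
      then have "2 ^ (M - j) \<le> k - 1" by simp
      then have "real_of_int (2 ^ (M - j)) \<le> real_of_int (k - 1)" by (rule of_int_le_iff[THEN iffD2])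
      then have "1 / 2 ^ j \<le> (real_of_int k - 1) / 2 ^ M"
        unfolding eq by (intro divide_right_mono) auto
      then have "I \<inter> {0..<1 / 2 ^ j} = {}" by (auto simp: I')
      then have "a x * indicator {0..<1 / 2 ^ j} x = 0" if "x \<in> {0..<1}" for x
        using that supp[of x] by (cases "x \<in> I") (auto simp: indicator_def)
      then have "(LINT x:{0..<1}|lebesgue. a x * indicator {0..<1 / 2 ^ j} x) = (LINT x:{0..<1::real}|lebesgue. 0)"
        by (intro set_lebesgue_integral_cong) auto
      then show ?thesis by (simp add: set_lebesgue_integral_def)
    qed
  next
    case False
    have "\<bar>LINT x:{0..<1}|lebesgue. a x * indicator {0..<1 / 2 ^ j} x\<bar> \<le>
        (LINT x|lebesgue. \<bar>indicator {0..<1} x *\<^sub>R (a x * indicator {0..<1 / 2 ^ j} x)\<bar>)"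
      unfolding set_lebesgue_integral_def by (rule integral_abs_bound)
    also have "\<dots> \<le> (LINT x|lebesgue. 2 ^ M * indicator {0..<1 / 2 ^ j :: real} x)"
    proof (rule integral_mono)
      show "integrable lebesgue (\<lambda>x. \<bar>indicator {0..<1} x *\<^sub>R (a x * indicator {0..<1 / 2 ^ j} x)\<bar>)"
        using iint[of j] unfolding set_integrable_def by (rule integrable_abs)
      show "integrable lebesgue (\<lambda>x. 2 ^ M * indicator {0..<1 / 2 ^ j :: real} x :: real)"
        by (intro integrable_mult_right integrable_real_indicator) auto
    qed (use abound in \<open>auto simp: indicator_def\<close>)
    also have "\<dots> = 2 ^ M / 2 ^ j" by simp
    finally show ?thesis using False by simp
  qed
  have "(LINT x:{0..<1}|lebesgue. a x * log_step N x) =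
      (\<Sum>j = 1..N. LINT x:{0..<1}|lebesgue. a x * indicator {0..<1 / 2 ^ j} x)"
    unfolding set_lebesgue_integral_def log_step_def sum_distrib_left scaleR_sum_right
    using iint by (intro Bochner_Integration.integral_sum) (simp only: set_integrable_def)
  also have "\<bar>\<dots>\<bar> \<le> (\<Sum>j = 1..N. if j \<le> M then 0 else 2 ^ M / 2 ^ j)"
    by (rule order_trans[OF sum_abs sum_mono[OF each]])
  also have "\<dots> \<le> 1 - (1/2) ^ (N - M)" by (rule sum_dyadic_tail)
  also have "\<dots> \<le> 1" by simp
  finally show ?thesis .
qed

text \<open>On [0, 1/2), where the truncated logarithms live, all summands are non-negative. Hence
  nothing cancels, and the pairing of \<open>f\<close> with \<open>log_step (4 ^ i)\<close> is at
  least that of its i-th summand, which is 2^i / 2.\<close>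

lemma H1_Torus_witness: "\<exists>f \<in> H1 Torus. f \<notin> H1_nadic Torus 2"
proof (rule bexI)
  define F where "F i x = (1/2) ^ i * circle_atom (4 ^ i) x" for i :: nat and x
  define f where "f x = (\<Sum>i. F i x)" for x
  define D :: "real set" where "D = {0..<1}"
  have D: "fundamental_domain Torus = D" by (simp add: D_def fundamental_domain_def)
  have k1: "(4::nat) ^ i \<ge> 1" for i by simp
  have aint: "set_integrable lebesgue D (circle_atom (4 ^ i))" for i
    using atom_integrable[OF circle_atom_atom[OF k1]] by (simp add: D)
  have Fint: "integrable lebesgue (\<lambda>x. indicator D x *\<^sub>R F i x)" for i
    using set_integrable_mult_right[OF aint, of "(1/2) ^ i" i]
    by (simp add: F_def set_integrable_def)
  \<comment> \<open>Away from 0 the sum is finite, since the supports shrink to 0 on the circle. At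
    0 itself the series diverges, whence the exclusion of that point here and in the
    almost-everywhere steps.\<close>
  have sumF: "summable (\<lambda>i. \<bar>F i x\<bar>)" if x: "x \<in> D" "x \<noteq> 0" for x
  proof -
    define d where "d = min x (1 - x)"
    have d: "d > 0" using x by (auto simp: d_def D_def)
    have "(\<lambda>i. (1/2::real) ^ i) \<longlonglongrightarrow> 0" by (intro LIMSEQ_power_zero) simp
    then have "\<forall>\<^sub>F i in sequentially. (1/2) ^ i < d" using d by (rule order_tendstoD)
    then have "\<forall>\<^sub>F i in sequentially. \<bar>F i x\<bar> = 0"
    proof eventually_elim
      case (elim i)
      have "i \<le> 4 ^ i" using less_exp[of i] power_mono[of 2 4 i] by simp
      then have "1 / 2 ^ (4 ^ i) \<le> (1/2::real) ^ i"
        using power_decreasing[of i "4 ^ i" "1/2::real"] by (simp add: power_one_over)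
      then show ?case using elim x by (auto simp: F_def circle_atom_def d_def D_def indicator_def)
    qed
    then show ?thesis by (subst summable_cong[of _ "\<lambda>_. 0"]) auto
  qed
  have sumF': "AE x in lebesgue. summable (\<lambda>i. norm (indicator D x *\<^sub>R F i x))"
    using AE_lebesgue_neq[of 0]
    by eventually_elim (use sumF in \<open>auto simp: indicator_def\<close>)
  have sumI: "summable (\<lambda>i. LINT x|lebesgue. norm (indicator D x *\<^sub>R F i x))"
  proof (rule summable_comparison_test')
    show "summable (\<lambda>i. (1/2::real) ^ i)" by (intro summable_geometric) simp
    fix i
    have "(LINT x|lebesgue. norm (indicator D x *\<^sub>R F i x)) = (1/2) ^ i * (LINT x:D|lebesgue. \<bar>circle_atom (4 ^ i) x\<bar>)"
      unfolding set_lebesgue_integral_def integral_mult_right_zero[symmetric]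
      by (intro Bochner_Integration.integral_cong) (auto simp: F_def abs_mult)
    also have "\<dots> \<le> (1/2) ^ i" using circle_atom_L1[OF k1, of i] by (simp add: D_def)
    finally show "norm (LINT x|lebesgue. norm (indicator D x *\<^sub>R F i x)) \<le> (1/2) ^ i"
      by (simp add: integral_nonneg_AE)
  qed
  have fint: "integrable lebesgue (\<lambda>x. indicator D x *\<^sub>R f x)"
  proof -
    have "integrable lebesgue (\<lambda>x. \<Sum>i. indicator D x *\<^sub>R F i x)"
      by (rule integrable_suminf[OF Fint sumF' sumI])
    moreover have "(\<lambda>x. \<Sum>i. indicator D x *\<^sub>R F i x) = (\<lambda>x. indicator D x *\<^sub>R f x)"
      by (auto simp: f_def indicator_def)
    ultimately show ?thesis by simp
  qed
  \<comment> \<open>The sum of absolute values is the majorant for dominated convergence, which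
    gives the L1 convergence demanded by the atomic decomposition.\<close>
  have wint: "integrable lebesgue (\<lambda>x. \<Sum>i. norm (indicator D x *\<^sub>R F i x))"
    by (rule integrable_suminf) (use Fint sumF' sumI in \<open>auto intro: integrable_norm\<close>)
  have "(\<lambda>N. LINT x|lebesgue. indicator D x *\<^sub>R \<bar>f x - (\<Sum>i<N. F i x)\<bar>) \<longlonglongrightarrow> integral\<^sup>L lebesgue (\<lambda>x::real. 0::real)"
  proof (rule integral_dominated_convergence[where w="\<lambda>x. \<Sum>i. norm (indicator D x *\<^sub>R F i x)"])
    show "(\<lambda>x. indicator D x *\<^sub>R \<bar>f x - (\<Sum>i<N. F i x)\<bar>) \<in> borel_measurable lebesgue" for N
    proof -
      have "integrable lebesgue (\<lambda>x. indicator D x *\<^sub>R f x - (\<Sum>i<N. indicator D x *\<^sub>R F i x))"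
        by (intro Bochner_Integration.integrable_diff Bochner_Integration.integrable_sum fint Fint)
      then have "integrable lebesgue (\<lambda>x. \<bar>indicator D x *\<^sub>R f x - (\<Sum>i<N. indicator D x *\<^sub>R F i x)\<bar>)"
        by (rule integrable_abs)
      moreover have "(\<lambda>x. \<bar>indicator D x *\<^sub>R f x - (\<Sum>i<N. indicator D x *\<^sub>R F i x)\<bar>) =
          (\<lambda>x. indicator D x *\<^sub>R \<bar>f x - (\<Sum>i<N. F i x)\<bar>)"
        by (auto simp: indicator_def)
      ultimately show ?thesis by (metis borel_measurable_integrable)
    qed
    show "AE x in lebesgue. (\<lambda>N. indicator D x *\<^sub>R \<bar>f x - (\<Sum>i<N. F i x)\<bar>) \<longlonglongrightarrow> 0"
      using AE_lebesgue_neq[of 0]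
    proof eventually_elim
      case (elim x)
      show ?case
      proof (cases "x \<in> D")
        case True
        have "(\<lambda>N. \<Sum>i<N. F i x) \<longlonglongrightarrow> f x"
          unfolding f_def using summable_rabs_cancel[OF sumF[OF True elim]] by (rule summable_LIMSEQ)
        then have "(\<lambda>N. \<bar>f x - (\<Sum>i<N. F i x)\<bar>) \<longlonglongrightarrow> \<bar>f x - f x\<bar>" by (intro tendsto_intros)
        then show ?thesis using True by simp
      qed simp
    qed
    show "AE x in lebesgue. norm (indicator D x *\<^sub>R \<bar>f x - (\<Sum>i<N. F i x)\<bar>) \<le> (\<Sum>i. norm (indicator D x *\<^sub>R F i x))" for N
      using AE_lebesgue_neq[of 0]
    proof eventually_elim
      case (elim x)
      show ?case
      proof (cases "x \<in> D")
        case True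
        note s = sumF[OF True elim]
        have "f x - (\<Sum>i<N. F i x) = (\<Sum>i. F (i + N) x)"
          unfolding f_def using suminf_minus_initial_segment[OF summable_rabs_cancel[OF s], of N] by simp
        also have "\<bar>\<dots>\<bar> \<le> (\<Sum>i. \<bar>F (i + N) x\<bar>)"
          using s by (intro summable_rabs) (simp add: summable_iff_shift[where f="\<lambda>i. \<bar>F i x\<bar>"])
        also have "\<dots> \<le> (\<Sum>i. \<bar>F i x\<bar>)"
          using suminf_split_initial_segment[OF s, of N] sum_nonneg[of "{..<N}" "\<lambda>i. \<bar>F i x\<bar>"] by simp
        finally show ?thesis using True by simp
      qed simp
    qed
  qed (rule borel_measurable_const wint)+
  then have lim: "(\<lambda>N. LINT x:D|lebesgue. \<bar>f x - (\<Sum>i<N. (1/2) ^ i * circle_atom (4 ^ i) x)\<bar>) \<longlonglongrightarrow> 0"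
    by (simp add: set_lebesgue_integral_def F_def)
  have per: "f \<in> functions_on Torus"
    by (simp add: functions_on_def f_def F_def circle_atom_def frac_1_eq)
  have "summable (\<lambda>i. \<bar>(1/2::real) ^ i\<bar>)" by (simp add: summable_geometric power_abs)
  then show "f \<in> H1 Torus"
    unfolding H1_def H1_over_def D using per fint lim circle_atom_atom[OF k1]
    by (auto simp: set_integrable_def intro!: exI[of _ "\<lambda>i. (1/2) ^ i"] exI[of _ "\<lambda>i. circle_atom (4 ^ i)"])
  show "f \<notin> H1_nadic Torus 2"
  proof
    assume "f \<in> H1_nadic Torus 2"
    then have f2: "f \<in> H1_over Torus (nadic_intervals Torus 2)" by (simp add: H1_nadic_def)
    obtain S where S: "\<forall>g B M. g \<in> borel_measurable lebesgue \<longrightarrow> (\<forall>x. \<bar>g x\<bar> \<le> B) \<longrightarrow> M \<ge> 0 \<longrightarrow>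
      (\<forall>I\<in>nadic_intervals Torus 2. \<forall>a. atom Torus I a \<longrightarrow>
        \<bar>LINT x:D|lebesgue. a x * g x\<bar> \<le> M) \<longrightarrow>
      \<bar>LINT x:D|lebesgue. f x * g x\<bar> \<le> M * S"
      using H1_pairing_bound[OF f2 nadic_intervals_subset[OF one_le_numeral], unfolded D] by blast
    have "2 ^ i \<le> 2 * S" for i :: nat
    proof -
      define k where "k = (4::nat) ^ i"
      have k: "k \<ge> 1" by (simp add: k_def)
      define e :: real where "e = 1 / 2 ^ k"
      have e: "0 < e" "e \<le> 1/2" using inv_power2_le_half[OF k] by (auto simp: e_def)
      let ?g = "log_step k"
      have gm: "?g \<in> borel_measurable lebesgue"
        unfolding log_step_def by (intro borel_measurable_sum borel_measurable_indicator) auto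
      have gb: "\<bar>?g x\<bar> \<le> real k" for x
      proof -
        have "\<bar>?g x\<bar> \<le> (\<Sum>j = 1..k. 1)"
          unfolding log_step_def by (rule order_trans[OF sum_abs sum_mono]) (simp add: indicator_def)
        then show ?thesis by simp
      qed
      have le: "\<bar>LINT x:D|lebesgue. f x * ?g x\<bar> \<le> 1 * S"
        by (rule S[rule_format, OF gm gb]) (use log_step_atom in \<open>auto simp: D_def\<close>)
      \<comment> \<open>Only the i-th summand on [0, e) is kept: there it has height 2^(k-1) / 2^i,
        and all k steps of the logarithm equal 1. Near the other end of [0,1), where the summands
        are negative, the logarithm vanishes.\<close>
      have "(LINT x|lebesgue. ((1/2) ^ i * 2 ^ (k - 1) * real k) * indicator {0..<e} x) \<le>
          (LINT x|lebesgue. indicator D x *\<^sub>R (f x * ?g x))"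
      proof (rule integral_mono_AE)
        show "integrable lebesgue (\<lambda>x. ((1/2) ^ i * 2 ^ (k - 1) * real k) * indicator {0..<e} x)"
          using e by (intro integrable_mult_right integrable_real_indicator) auto
        show "integrable lebesgue (\<lambda>x. indicator D x *\<^sub>R (f x * ?g x))"
          using set_integrable_mult_bounded(1)[OF _ gm gb, of D f] fint by (simp add: set_integrable_def)
        show "AE x in lebesgue. ((1/2) ^ i * 2 ^ (k - 1) * real k) * indicator {0..<e} x \<le>
            indicator D x *\<^sub>R (f x * ?g x)"
          using AE_lebesgue_neq[of 0]
        proof eventually_elim
          case (elim x)
          have g0: "0 \<le> ?g x" unfolding log_step_def by (rule sum_nonneg) simp
          show ?case
          proof (cases "0 \<le> x \<and> x < 1/2")
            case True
            then have xD: "x \<in> D" by (simp add: D_def)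
            have Fpos: "0 \<le> F j x" for j
              unfolding F_def using circle_atom_nonneg[OF k1] True by simp
            have "F i x \<le> f x"
              unfolding f_def
              using sum_le_suminf[OF summable_rabs_cancel[OF sumF[OF xD elim]], of "{i}"] Fpos by simp
            then have fx: "F i x * ?g x \<le> f x * ?g x" using g0 by (rule mult_right_mono)
            show ?thesis
            proof (cases "x < e")
              case xe: True
              have "x < 1 / 2 ^ j" if "j \<in> {1..k}" for j
              proof -
                have "e \<le> 1 / 2 ^ j"
                  using power_decreasing[of j k "1/2::real"] that by (simp add: e_def power_one_over)
                then show ?thesis using xe by simp
              qed
              then have "?g x = (\<Sum>j = 1..k. 1)"
                unfolding log_step_def using True by (intro sum.cong) (auto simp: indicator_def)
              then have gx: "?g x = real k" by simp
              have "F i x = (1/2) ^ i * 2 ^ (k - 1)"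
                unfolding F_def k_def[symmetric] circle_atom_def
                using True xe e xD by (auto simp: e_def[symmetric] D_def indicator_def)
              then show ?thesis using fx gx xD xe True by simp
            next
              case False
              have "0 \<le> F i x * ?g x" using Fpos g0 by simp
              then show ?thesis using fx xD False by simp
            qed
          next
            case False
            have "?g x = 0"
              unfolding log_step_def
            proof (rule sum.neutral, safe)
              fix j assume "j \<in> {1..k}"
              then have "1 / 2 ^ j \<le> (1/2 :: real)" using inv_power2_le_half[of j] by simp
              then have "x \<notin> {0..<1 / 2 ^ j}" using False unfolding atLeastLessThan_iff by linarith
              then show "indicator {0..<1 / 2 ^ j} x = (0::real)" by simp
            qed
            then show ?thesis using False e by (auto simp: indicator_def)
          qed
        qed
      qed
      \<comment> \<open>The left side is 2^i / 2, because 2^(k-1) e = 1/2 and k = 4^i.\<close>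
      then have "(1/2) ^ i * 2 ^ (k - 1) * real k * e \<le> S"
        using le e by (simp add: set_lebesgue_integral_def)
      moreover have "2 ^ (k - 1) * e = 1 / 2" using k by (cases k) (auto simp: e_def)
      moreover have "(1/2) ^ i * real k = 2 ^ i"
        using power_mult_distrib[of "2::real" 2 i] by (simp add: k_def power_one_over)
      moreover have "(1/2) ^ i * 2 ^ (k - 1) * real k * e = (2 ^ (k - 1) * e) * ((1/2) ^ i * real k)"
        by (simp only: mult_ac)
      ultimately have "1 / 2 * 2 ^ i \<le> S" by (simp only:)
      then show ?thesis by simp
    qed
    moreover obtain i where "2 * S < 2 ^ i" using real_arch_pow[of 2 "2 * S"] by auto
    ultimately show False by (metis not_le)
  qed
qed

lemma H1_strict: "(\<Inter>n\<in>{2..}. H1_nadic s n) \<subset> H1 s"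
proof (rule psubsetI)
  show "(\<Inter>n\<in>{2..}. H1_nadic s n) \<subseteq> H1 s"
    using H1_over_mono[OF nadic_intervals_subset[of 2 s], of s] by (auto simp: H1_def H1_nadic_def)
  have "\<exists>f \<in> H1 s. f \<notin> H1_nadic s 2"
    using H1_Line_witness H1_Torus_witness by (cases s) auto
  then show "(\<Inter>n\<in>{2..}. H1_nadic s n) \<noteq> H1 s" by auto
qed

theorem theorem1p3:
  fixes s :: ambient
  shows "(\<forall>r::real. 1 \<le> r \<longrightarrow> RH s r \<subset> (\<Inter>n\<in>{2..}. RH_nadic s n r)) \<and>
    (\<forall>r::ereal. 1 < r \<and> r \<le> \<infinity> \<longrightarrow> A s r \<subset> (\<Inter>n\<in>{2..}. A_nadic s n r)) \<and>
    BMO s \<subset> (\<Inter>n\<in>{2..}. BMO_nadic s n) \<and>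
    (\<Inter>n\<in>{2..}. H1_nadic s n) \<subset> H1 s \<and>
    VMO s \<subset> (\<Inter>n\<in>{2..}. VMO_nadic s n)"
proof (intro conjI allI impI)
  show "RH s r \<subset> (\<Inter>n\<in>{2..}. RH_nadic s n r)" if "1 \<le> r" for r
    using that by (rule RH_strict)
  show "A s r \<subset> (\<Inter>n\<in>{2..}. A_nadic s n r)" if "1 < r \<and> r \<le> \<infinity>" for r
    using that by (intro A_strict) auto
  show "BMO s \<subset> (\<Inter>n\<in>{2..}. BMO_nadic s n)" by (rule BMO_strict)
  show "(\<Inter>n\<in>{2..}. H1_nadic s n) \<subset> H1 s" by (rule H1_strict)
  show "VMO s \<subset> (\<Inter>n\<in>{2..}. VMO_nadic s n)" by (rule VMO_strict)
qed

end
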